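(* Let $\lambda = (\lambda_1,\ldots,\lambda_I)$ and $\mu = (\mu_1,\ldots,\mu_J)$ be two partitions of $n$. Let $\sigma \in S_n$ be a permutation chosen uniformly at random from a fixed double coset in $S_\lambda \backslash S_n / S_\mu$ indexed by $T$. Suppose $T_{k\ell} \geq 1$ for all $1 \leq k \leq I$, $1 \leq \ell \leq J$ such that $A_{k\ell} \neq \emptyset$. Let $Y_n$ be a Poisson random variable with rate $\nu_n := E(\mathrm{fp}(\sigma))$. Then $$d_{TV}(\mathrm{fp}(\sigma), Y_n) \leq \frac{5(I+J-1)\min\{1,\nu_n^{-1}\}}{\max\{\lambda_I,\mu_J\}}.$$ Moreover, suppose that for each $n$ partitions $\lambda=\lambda^{(n)}$, $\mu=\mu^{(n)}$ of $n$ and an $I\times J$ table $T=T^{(n)}$ with nonnegative integer entries, row sums $\lambda$ and column sums $\mu$, satisfying $T_{k\ell}\geq 1$ for all $1\leq k\leq I$, $1\leq \ell\leq J$ such that $A_{k\ell}\neq\emptyset$, are given, and that $\sigma\in S_n$ is chosen uniformly at random from the double coset in $S_\lambda\backslash S_n/S_\mu$ indexed by $T$, with $\nu_n=E(\mathrm{fp}(\sigma))$ (so $I$, $J$, $\lambda_I$, $\mu_J$, $\nu_n$ depend on $n$). If the partitions also satisfy (1) $\lim_{n\to\infty}\lambda_I=\infty$ and $\lim_{n\to\infty}\mu_J=\infty$, and (2) $\lim_{n\to\infty}(I+J-1)=C$ for some constant $C\in\mathbb{N}$, and if $\limsup_{n\to\infty}\nu_n=\nu<\infty$, then $d_{TV}(\mathrm{fp}(\sigma),Y)\to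 0$ as $n\to\infty$, where $Y$ is a Poisson random variable with rate $\nu$, so that $\mathrm{fp}(\sigma)$ converges in distribution to $Y$.
   Context: A partition $\lambda=(\lambda_1,\ldots,\lambda_I)$ of $n$ satisfies $\lambda_1\ge\dots\ge\lambda_I>0$ and $\lambda_1+\dots+\lambda_I=n$. Its $\lambda_i$-block is $L_i=\{\lambda_1+\dots+\lambda_{i-1}+1,\ldots,\lambda_1+\dots+\lambda_i\}$; the $\mu_j$-block $M_j$ is defined analogously for $\mu=(\mu_1,\ldots,\mu_J)$. The parabolic subgroup $S_\lambda\cong S_{\lambda_1}\times\dots\times S_{\lambda_I}$ is the set of permutations in $S_n$ preserving each block $L_i$ (similarly $S_\mu$). For $\sigma\in S_n$, the contingency table $T(\sigma)$ is the $I\times J$ table whose entry $T_{ij}$ is the number of elements of $M_j$ occurring in the positions of $\sigma$ given by $L_i$, i.e. $T_{ij}=|\{p\in L_i:\sigma(p)\in M_j\}|$; it has row sums $\lambda$ and column sums $\mu$. The parabolic double cosets in $S_\lambda\backslash S_n/S_\mu$ are in bijection with the nonnegative integer tables with row sums $\lambda$ and column sums $\mu$; the double coset indexed by $T$ is the set of all $\sigma\in S_n$ with $T(\sigma)=T$. $A_{k\ell}:=L_k\cap M_\ell\subseteq[n]=\{1,\ldots,n\}$. $\mathrm{fp}(\sigma)$ is the number of fixed points of $\sigma$, i.e. of $i\in[n]$ with $\sigma(i)=i$. $d_{TV}(X,Y)=\sup_A|P(X\in A)-P(Y\in A)|$ is the total variation distance between the distributions of $X$ and $Y$.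
   Formalization: In the second part it is additionally assumed that ν_n converges (so ν_n → ν); with only limsup ν_n = ν the claim fails, since ν_n may oscillate, e.g. between 2 and 2/m for λ = μ = (m,m). *)

theory Defs
  imports "HOL-Probability.Probability"
begin

text \<open>
  A partition is the list of its parts, so the part written \<open>\<lambda>\<^sub>i\<close> on paper is
  \<open>lam ! (i - 1)\<close>, the number \<open>I\<close> of parts is \<open>length lam\<close>, and the smallest part
  \<open>\<lambda>\<^sub>I\<close> is \<open>last lam\<close>. Block and table indices are 0-based; the elements of the
  blocks are the points \<open>1, ..., n\<close>.
\<close>

definition is_partition :: "nat \<Rightarrow> nat list \<Rightarrow> bool" where
  "is_partition n lam \<longleftrightarrow>
     sorted_wrt (\<ge>) lam \<and> (\<forall>x\<in>set lam. 0 < x) \<and> sum_list lam = n"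

definition block :: "nat list \<Rightarrow> nat \<Rightarrow> nat set" where
  "block lam i = {sum_list (take i lam) + 1 .. sum_list (take (Suc i) lam)}"

definition A_cell :: "nat list \<Rightarrow> nat list \<Rightarrow> nat \<Rightarrow> nat \<Rightarrow> nat set" where
  "A_cell lam mu k l = block lam k \<inter> block mu l"

text \<open>Entries of \<open>T\<close> outside the \<open>I \<times> J\<close> range are irrelevant.\<close>

definition has_margins :: "nat list \<Rightarrow> nat list \<Rightarrow> (nat \<Rightarrow> nat \<Rightarrow> nat) \<Rightarrow> bool" where
  "has_margins lam mu T \<longleftrightarrow>
     (\<forall>i<length lam. (\<Sum>j<length mu. T i j) = lam ! i) \<and>
     (\<forall>j<length mu. (\<Sum>i<length lam. T i j) = mu ! j)"

definition table :: "nat list \<Rightarrow> nat list \<Rightarrow> (nat \<Rightarrow> nat) \<Rightarrow> nat \<Rightarrow> nat \<Rightarrow> nat" where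
  "table lam mu \<sigma> i j = card {p \<in> block lam i. \<sigma> p \<in> block mu j}"

text \<open>
  The orbits of \<open>S\<^sub>\<lambda> \<times> S\<^sub>\<mu>\<close> (permuting positions within the \<open>L\<^sub>i\<close> and values within the
  \<open>M\<^sub>j\<close>) on \<open>S\<^sub>n\<close> are the nonempty fibres of \<open>\<sigma> \<mapsto> T(\<sigma>)\<close>; the double coset indexed by \<open>T\<close> is
  the fibre over \<open>T\<close>.
\<close>

definition double_coset ::
    "nat \<Rightarrow> nat list \<Rightarrow> nat list \<Rightarrow> (nat \<Rightarrow> nat \<Rightarrow> nat) \<Rightarrow> (nat \<Rightarrow> nat) set" where
  "double_coset n lam mu T =
     {\<sigma>. \<sigma> permutes {1..n} \<and>
          (\<forall>i<length lam. \<forall>j<length mu. table lam mu \<sigma> i j = T i j)}"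

definition fp :: "nat \<Rightarrow> (nat \<Rightarrow> nat) \<Rightarrow> nat" where
  "fp n \<sigma> = card {i \<in> {1..n}. \<sigma> i = i}"

definition fp_dist :: "nat \<Rightarrow> nat list \<Rightarrow> nat list \<Rightarrow> (nat \<Rightarrow> nat \<Rightarrow> nat) \<Rightarrow> nat pmf" where
  "fp_dist n lam mu T = map_pmf (fp n) (pmf_of_set (double_coset n lam mu T))"

definition fp_mean :: "nat \<Rightarrow> nat list \<Rightarrow> nat list \<Rightarrow> (nat \<Rightarrow> nat \<Rightarrow> nat) \<Rightarrow> real" where
  "fp_mean n lam mu T =
     measure_pmf.expectation (pmf_of_set (double_coset n lam mu T)) (\<lambda>\<sigma>. real (fp n \<sigma>))"

definition d_TV :: "'a pmf \<Rightarrow> 'a pmf \<Rightarrow> real" where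
  "d_TV p q = (SUP A. \<bar>measure_pmf.prob p A - measure_pmf.prob q A\<bar>)"

text \<open>
  The library's \<^const>\<open>poisson_pmf\<close> is specified only for positive rates; a limiting rate can
  be 0, where the Poisson distribution is the point mass at 0. Negative rates do not occur.
\<close>

definition poisson_dist :: "real \<Rightarrow> nat pmf" where
  "poisson_dist r = (if r > 0 then poisson_pmf r else return_pmf 0)"

end

theory Submission
  imports Defs
begin

text \<open>
  Write \<open>D\<close> for the double coset, \<open>w = \<lambda>\<^sub>k\<mu>\<^sub>l\<close> for a cell \<open>A\<^sub>k\<^sub>l\<close>, and \<open>W\<close> for the number of fixed points
  of a uniform \<open>\<sigma> \<in> D\<close>. The proof is Stein's method with a size-bias coupling.

  Stein's method reduces the distance between \<open>W\<close> and a Poisson variable of rate \<open>\<nu>\<close> to bounding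
  \<open>E (\<nu> h(W + 1) - W h(W))\<close> for functions \<open>h\<close> with increments of size at most 1; the factor
  \<open>min {1, 1/\<nu>}\<close> is the bound on the increments of the solution of Stein's equation
  (\<open>abs_stein_solution_increment_le\<close>, \<open>d_TV_poisson_le\<close>).

  As \<open>W\<close> is a sum of indicators of \<open>\<sigma> i = i\<close>, the expectation splits into one term for each point \<open>i\<close>,
  comparing \<open>W + 1\<close> with the number of fixed points of a uniform element of \<open>D\<close> that fixes \<open>i\<close>. The
  two are coupled by surgery: for \<open>i \<in> A\<^sub>k\<^sub>l\<close> choose \<open>j \<in> L\<^sub>k\<close> with \<open>\<sigma> j \<in> M\<^sub>l\<close> uniformly (there are \<open>T\<^sub>k\<^sub>l\<close>
  such \<open>j\<close>), exchange the positions \<open>i\<close> and \<open>j\<close> of \<open>\<sigma>\<close>, and then the values \<open>i\<close> and \<open>\<sigma> j\<close>. Both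
  exchanges stay within a block, so the table is kept; the result fixes \<open>i\<close>; and it is uniform among
  such permutations because every one of them arises from exactly \<open>w\<close> pairs \<open>(\<sigma>, j)\<close>
  (\<open>sum_graft\<close>). In particular \<open>P(\<sigma> i = i) = T\<^sub>k\<^sub>l / w\<close>.

  The surgery changes \<open>W + 1\<close> by at most the number of true statements among \<open>\<sigma> i = i\<close>, \<open>\<sigma> j = j\<close>,
  \<open>\<sigma> i = j\<close>, \<open>\<sigma> (\<sigma> j) = i\<close> (\<open>fp_graft\<close>). Counting triples \<open>(i, \<sigma>, j)\<close> with \<open>i\<close> in a fixed cell, each
  of the four statements holds for at most \<open>min {\<lambda>\<^sub>k, \<mu>\<^sub>l} |D|\<close> of them (\<open>sum_disturbance_le\<close>): the
  first two by the formula for \<open>P(\<sigma> i = i)\<close>, the last two because \<open>\<sigma>\<close> and \<open>j\<close> determine \<open>i\<close>. Dividing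
  by \<open>w\<close>, a cell contributes at most \<open>4 / max {\<lambda>\<^sub>k, \<mu>\<^sub>l} \<le> 4 / max {\<lambda>\<^sub>I, \<mu>\<^sub>J}\<close>. At most \<open>I + J - 1\<close> cells are nonempty, since
  the largest element of a cell is the end of a row block or of a column block
  (\<open>card_nonempty_cells\<close>). This yields the bound, with constant 4.

  For the limit, \<open>\<nu>\<^sub>n\<close> converges to its upper limit \<open>\<nu>\<close>, and two Poisson distributions are no further
  apart than their rates (\<open>d_TV_poisson_dist_le\<close>), so the triangle inequality finishes the proof;
  convergence in total variation gives convergence of distribution functions.
\<close>

section \<open>Total variation distance\<close>

lemma d_TV_le:
  assumes "\<And>A. \<bar>measure_pmf.prob p A - measure_pmf.prob q A\<bar> \<le> B"
  shows "d_TV p q \<le> B"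
  unfolding d_TV_def by (rule cSUP_least) (use assms in auto)

lemma prob_diff_le_d_TV: "\<bar>measure_pmf.prob p A - measure_pmf.prob q A\<bar> \<le> d_TV p q"
  unfolding d_TV_def
proof (rule cSUP_upper)
  have "\<bar>measure_pmf.prob p A - measure_pmf.prob q A\<bar> \<le> 1" for A
    using measure_pmf.prob_le_1[of p A] measure_pmf.prob_le_1[of q A]
      measure_nonneg[of p A] measure_nonneg[of q A] by linarith
  then show "bdd_above (range (\<lambda>A. \<bar>measure_pmf.prob p A - measure_pmf.prob q A\<bar>))"
    by (intro bdd_aboveI[of _ 1]) auto
qed simp

lemma d_TV_nonneg: "0 \<le> d_TV p q"
  using prob_diff_le_d_TV[of p "{}" q] by simp

lemma d_TV_triangle: "d_TV p r \<le> d_TV p q + d_TV q r"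
proof (rule d_TV_le)
  fix A
  show "\<bar>measure_pmf.prob p A - measure_pmf.prob r A\<bar> \<le> d_TV p q + d_TV q r"
    using prob_diff_le_d_TV[of p A q] prob_diff_le_d_TV[of q A r] by linarith
qed

section \<open>Stein's method for the Poisson distribution\<close>

lemma sums_prob_atLeast:
  fixes p :: "nat pmf"
  shows "(\<lambda>r. pmf p (k + r)) sums measure_pmf.prob p {k..}"
proof -
  have "(\<lambda>r. measure_pmf.prob p {k + r}) sums measure_pmf.prob p (\<Union>r. {k + r})"
    by (rule measure_pmf.finite_measure_UNION) (auto simp: disjoint_family_on_def)
  moreover have "(\<Union>r. {k + r}) = {k..}"
    by (auto simp: le_iff_add)
  ultimately show ?thesis by (simp add: measure_pmf_single)
qed

lemma pmf_poisson_Suc: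
  assumes "\<nu> > 0"
  shows "real (Suc r) * pmf (poisson_pmf \<nu>) (Suc r) = \<nu> * pmf (poisson_pmf \<nu>) r"
  using assms by (simp add: divide_simps)

text \<open>
  The recursion \<open>r p(r) = \<nu> p(r - 1)\<close> shifts a sum over the upper tail by one place, after \<open>k\<close> has been
  bounded by the summation index. The lower tail is treated in the same way. These two inequalities
  give the signs in the increment of the Stein solution.
\<close>

lemma poisson_upper_tail:
  assumes "\<nu> > 0"
  shows "real k * measure_pmf.prob (poisson_pmf \<nu>) {Suc k..} \<le> \<nu> * measure_pmf.prob (poisson_pmf \<nu>) {k..}"
proof (rule sums_le)
  show "(\<lambda>r. real k * pmf (poisson_pmf \<nu>) (Suc k + r)) sums
      (real k * measure_pmf.prob (poisson_pmf \<nu>) {Suc k..})"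
    by (intro sums_mult sums_prob_atLeast)
  show "(\<lambda>r. \<nu> * pmf (poisson_pmf \<nu>) (k + r)) sums (\<nu> * measure_pmf.prob (poisson_pmf \<nu>) {k..})"
    by (intro sums_mult sums_prob_atLeast)
  fix r
  have "real k * pmf (poisson_pmf \<nu>) (Suc (k + r)) \<le> real (Suc (k + r)) * pmf (poisson_pmf \<nu>) (Suc (k + r))"
    by (intro mult_right_mono) auto
  then show "real k * pmf (poisson_pmf \<nu>) (Suc k + r) \<le> \<nu> * pmf (poisson_pmf \<nu>) (k + r)"
    unfolding pmf_poisson_Suc[OF assms] by simp
qed

lemma poisson_lower_tail:
  assumes "\<nu> > 0"
  shows "\<nu> * measure_pmf.prob (poisson_pmf \<nu>) {..<k}
    \<le> real k * (measure_pmf.prob (poisson_pmf \<nu>) {..k} - pmf (poisson_pmf \<nu>) 0)"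
proof -
  have "\<nu> * measure_pmf.prob (poisson_pmf \<nu>) {..<k} = (\<Sum>r<k. \<nu> * pmf (poisson_pmf \<nu>) r)"
    by (simp add: measure_measure_pmf_finite sum_distrib_left)
  also have "\<dots> = (\<Sum>r<k. real (Suc r) * pmf (poisson_pmf \<nu>) (Suc r))"
    by (simp only: pmf_poisson_Suc[OF assms])
  also have "\<dots> \<le> (\<Sum>r<k. real k * pmf (poisson_pmf \<nu>) (Suc r))"
    by (intro sum_mono mult_right_mono) auto
  also have "\<dots> = real k * (measure_pmf.prob (poisson_pmf \<nu>) {..k} - pmf (poisson_pmf \<nu>) 0)"
    by (simp add: measure_measure_pmf_finite sum.atMost_shift sum_distrib_left del: pmf_poisson)
  finally show ?thesis .
qed

text \<open>
  The solution \<open>f\<close> of Stein's equation \<open>\<nu> f(k + 1) - k f(k) = 1\<^sub>A(k) - P(A)\<close>, obtained by solving this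
  recursion upwards from \<open>k = 0\<close>. The value at 0 is 0, by division by zero; the equation multiplies
  it by 0.
\<close>

definition stein_solution :: "real \<Rightarrow> nat set \<Rightarrow> nat \<Rightarrow> real" where
  "stein_solution \<nu> A k =
     (measure_pmf.prob (poisson_pmf \<nu>) (A \<inter> {..<k})
        - measure_pmf.prob (poisson_pmf \<nu>) A * measure_pmf.prob (poisson_pmf \<nu>) {..<k})
     / (real k * pmf (poisson_pmf \<nu>) k)"

lemma prob_Int_lessThan_Suc:
  "measure_pmf.prob p (A \<inter> {..<Suc k}) = measure_pmf.prob p (A \<inter> {..<k}) + indicator A k * pmf p k"
proof -
  have "measure_pmf.prob p (A \<inter> {..<Suc k}) = measure_pmf.prob p ((A \<inter> {..<k}) \<union> (A \<inter> {k}))"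
    by (rule arg_cong[where f = "measure_pmf.prob p"]) auto
  also have "\<dots> = measure_pmf.prob p (A \<inter> {..<k}) + measure_pmf.prob p (A \<inter> {k})"
    by (rule measure_pmf.finite_measure_Union) auto
  finally show ?thesis
    by (cases "k \<in> A") (auto simp: measure_pmf_single)
qed

lemma prob_split_lessThan:
  fixes p :: "nat pmf"
  shows "measure_pmf.prob p A = measure_pmf.prob p (A \<inter> {..<k}) + measure_pmf.prob p (A \<inter> {k..})"
proof -
  have "measure_pmf.prob p A = measure_pmf.prob p ((A \<inter> {..<k}) \<union> (A \<inter> {k..}))"
    by (rule arg_cong[where f = "measure_pmf.prob p"]) auto
  also have "\<dots> = measure_pmf.prob p (A \<inter> {..<k}) + measure_pmf.prob p (A \<inter> {k..})"
    by (rule measure_pmf.finite_measure_Union) auto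
  finally show ?thesis .
qed

lemma stein_equation:
  assumes "\<nu> > 0"
  shows "\<nu> * stein_solution \<nu> A (Suc k) - real k * stein_solution \<nu> A k
    = indicator A k - measure_pmf.prob (poisson_pmf \<nu>) A"
proof -
  define p where "p = poisson_pmf \<nu>"
  have pos: "pmf p r > 0" for r
    using assms by (simp add: p_def)
  have step: "real (Suc k) * pmf p (Suc k) = \<nu> * pmf p k"
    unfolding p_def by (rule pmf_poisson_Suc[OF assms])
  have 1: "\<nu> * stein_solution \<nu> A (Suc k) = (measure_pmf.prob p (A \<inter> {..<Suc k})
        - measure_pmf.prob p A * measure_pmf.prob p {..<Suc k}) / pmf p k"
    unfolding stein_solution_def p_def[symmetric] step using assms by simp
  have 2: "real k * stein_solution \<nu> A k = (measure_pmf.prob p (A \<inter> {..<k})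
        - measure_pmf.prob p A * measure_pmf.prob p {..<k}) / pmf p k"
    unfolding stein_solution_def p_def[symmetric] using pos[of k] by (cases "k = 0") auto
  show ?thesis
    unfolding 1 2 p_def[symmetric] using pos[of k] prob_Int_lessThan_Suc[of p A k]
      prob_Int_lessThan_Suc[of p UNIV k]
    by (simp add: field_simps)
qed

lemma stein_solution_Compl: "stein_solution \<nu> (- A) k = - stein_solution \<nu> A k"
proof -
  have "measure_pmf.prob (poisson_pmf \<nu>) {..<k} =
      measure_pmf.prob (poisson_pmf \<nu>) ((A \<inter> {..<k}) \<union> (- A \<inter> {..<k}))"
    by (rule arg_cong[where f = "measure_pmf.prob _"]) auto
  also have "\<dots> = measure_pmf.prob (poisson_pmf \<nu>) (A \<inter> {..<k})
      + measure_pmf.prob (poisson_pmf \<nu>) (- A \<inter> {..<k})"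
    by (rule measure_pmf.finite_measure_Union) auto
  finally have "measure_pmf.prob (poisson_pmf \<nu>) (- A \<inter> {..<k}) =
      measure_pmf.prob (poisson_pmf \<nu>) {..<k} - measure_pmf.prob (poisson_pmf \<nu>) (A \<inter> {..<k})"
    by simp
  moreover have "measure_pmf.prob (poisson_pmf \<nu>) (- A) = 1 - measure_pmf.prob (poisson_pmf \<nu>) A"
    using measure_pmf.prob_compl[of A "poisson_pmf \<nu>"] by (simp add: Compl_eq_Diff_UNIV)
  ultimately show ?thesis
    unfolding stein_solution_def minus_divide_left by (simp only:) (simp add: algebra_simps)
qed

text \<open>
  Split \<open>P(A)\<close> into the parts \<open>a\<close>, \<open>b\<close>, \<open>c\<close> below, at and above \<open>k\<close>. The increment is linear in these, and
  the coefficients of \<open>a\<close> and \<open>c\<close> are nonpositive by the two tail inequalities. So it is largest for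
  \<open>A = {k}\<close>, where a tail inequality bounds it by \<open>(1 - e\<^sup>-\<^sup>\<nu>) / \<nu>\<close>.
\<close>

lemma stein_solution_increment_le:
  assumes \<nu>: "\<nu> > 0" and k: "k \<ge> 1"
  shows "stein_solution \<nu> A (Suc k) - stein_solution \<nu> A k \<le> (1 - exp (- \<nu>)) / \<nu>"
proof -
  define p where "p = poisson_pmf \<nu>"
  define a b c F q G where "a = measure_pmf.prob p (A \<inter> {..<k})"
    and "b = indicator A k * pmf p k"
    and "c = measure_pmf.prob p (A \<inter> {Suc k..})"
    and "F = measure_pmf.prob p {..<k}" and "q = pmf p k"
    and "G = measure_pmf.prob p {Suc k..}"
  note defs = a_def b_def c_def F_def q_def G_def
  have q: "q > 0"
    using \<nu> by (simp add: q_def p_def)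
  have kpos: "real k > 0" using k by simp
  have step: "real (Suc k) * pmf p (Suc k) = \<nu> * q"
    unfolding p_def q_def by (rule pmf_poisson_Suc[OF \<nu>])
  have nonneg: "a \<ge> 0" "c \<ge> 0" "b \<le> q" "b \<ge> 0" "F \<ge> 0" "G \<ge> 0"
    using q by (auto simp: defs indicator_def)
  have A: "measure_pmf.prob p (A \<inter> {..<Suc k}) = a + b"
    using prob_Int_lessThan_Suc[of p A k] by (simp add: defs)
  have PA: "measure_pmf.prob p A = a + b + c"
    using prob_split_lessThan[of p A "Suc k"] A by (simp add: defs)
  have U: "measure_pmf.prob p {..<Suc k} = F + q"
    using prob_Int_lessThan_Suc[of p UNIV k] by (simp add: defs)
  have one: "F + q + G = 1"
    using prob_split_lessThan[of p UNIV "Suc k"] U by (simp add: defs)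
  have "measure_pmf.prob p {k..} = q + G"
    using one prob_split_lessThan[of p UNIV k] by (simp add: defs)
  then have up: "real k * G \<le> \<nu> * (q + G)"
    using poisson_upper_tail[OF \<nu>, of k] by (simp add: G_def p_def)
  have low: "\<nu> * F \<le> real k * (F + q - exp (- \<nu>))"
    using poisson_lower_tail[OF \<nu>, of k] U \<nu>
    by (simp add: defs p_def lessThan_Suc_atMost del: lessThan_Suc)
  have f1: "stein_solution \<nu> A (Suc k) = ((a + b) * G - c * (F + q)) / (\<nu> * q)"
  proof -
    have "stein_solution \<nu> A (Suc k) = ((a + b) - (a + b + c) * (F + q)) / (\<nu> * q)"
      unfolding stein_solution_def p_def[symmetric] A PA U step ..
    also have "(a + b) - (a + b + c) * (F + q) = (a + b) * G - c * (F + q)"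
      using one by algebra
    finally show ?thesis .
  qed
  have f0: "stein_solution \<nu> A k = (a * (G + q) - (b + c) * F) / (real k * q)"
  proof -
    have "stein_solution \<nu> A k = (a - (a + b + c) * F) / (real k * q)"
      unfolding stein_solution_def p_def[symmetric] PA a_def F_def q_def ..
    also have "a - (a + b + c) * F = a * (G + q) - (b + c) * F"
      using one by algebra
    finally show ?thesis .
  qed
  have "(stein_solution \<nu> A (Suc k) - stein_solution \<nu> A k) * (\<nu> * real k * q)
      = a * (real k * G - \<nu> * (q + G)) + b * (real k * G + \<nu> * F) + c * (\<nu> * F - real k * (F + q))"
    unfolding f0 f1 using q kpos \<nu> by (simp add: field_simps)
  also have "\<dots> \<le> 0 + q * (real k * (1 - exp (- \<nu>))) + 0"
  proof (intro add_mono)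
    show "a * (real k * G - \<nu> * (q + G)) \<le> 0"
      using nonneg up by (intro mult_nonneg_nonpos) auto
    have "real k * (F + q - exp (- \<nu>)) \<le> real k * (F + q)"
      by (intro mult_left_mono) auto
    with low have "\<nu> * F - real k * (F + q) \<le> 0" by linarith
    then show "c * (\<nu> * F - real k * (F + q)) \<le> 0"
      using nonneg by (intro mult_nonneg_nonpos) auto
    have "real k * G + \<nu> * F \<le> real k * (1 - exp (- \<nu>))"
      using low by (simp add: algebra_simps flip: one)
    then show "b * (real k * G + \<nu> * F) \<le> q * (real k * (1 - exp (- \<nu>)))"
      using nonneg \<nu> q by (intro mult_mono) auto
  qed
  also have "\<dots> = ((1 - exp (- \<nu>)) / \<nu>) * (\<nu> * real k * q)"
    using \<nu> by (simp add: field_simps)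
  finally show ?thesis
    using \<nu> kpos q by (simp add: mult_le_cancel_right pos_le_divide_eq)
qed

text \<open>
  The lower bound is the upper bound for the complement of \<open>A\<close>, whose solution is the negative one.
\<close>

lemma abs_stein_solution_increment_le:
  assumes \<nu>: "\<nu> > 0" and k: "k \<ge> 1"
  shows "\<bar>stein_solution \<nu> A (Suc k) - stein_solution \<nu> A k\<bar> \<le> min 1 (inverse \<nu>)"
proof -
  have "\<bar>stein_solution \<nu> A (Suc k) - stein_solution \<nu> A k\<bar> \<le> (1 - exp (- \<nu>)) / \<nu>"
    using stein_solution_increment_le[OF \<nu> k, of A] stein_solution_increment_le[OF \<nu> k, of "- A"]
    by (simp add: stein_solution_Compl)
  also have "\<dots> \<le> min 1 (inverse \<nu>)"
    using \<nu> exp_ge_add_one_self[of "- \<nu>"] by (simp add: field_simps)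
  finally show ?thesis .
qed

text \<open>
  Apply the hypothesis to the Stein solution, rescaled to have increments of size at most 1. Only
  increments from \<open>k \<ge> 1\<close> on are controlled; the value of \<open>h\<close> at 0 is always multiplied by 0.
\<close>

lemma d_TV_poisson_le:
  fixes p :: "nat pmf"
  assumes \<nu>: "\<nu> > 0"
    and bound: "\<And>h :: nat \<Rightarrow> real. (\<And>k. k \<ge> 1 \<Longrightarrow> \<bar>h (Suc k) - h k\<bar> \<le> 1) \<Longrightarrow>
      \<bar>measure_pmf.expectation p (\<lambda>w. \<nu> * h (Suc w) - real w * h w)\<bar> \<le> B"
  shows "d_TV p (poisson_pmf \<nu>) \<le> min 1 (inverse \<nu>) * B"
proof (rule d_TV_le)
  fix A
  define c where "c = min 1 (inverse \<nu>)"
  have c: "c > 0" using \<nu> by (simp add: c_def)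
  define h where "h k = stein_solution \<nu> A k / c" for k
  have "\<bar>h (Suc k) - h k\<bar> \<le> 1" if "k \<ge> 1" for k
  proof -
    have "\<bar>h (Suc k) - h k\<bar> = \<bar>stein_solution \<nu> A (Suc k) - stein_solution \<nu> A k\<bar> / c"
      unfolding h_def using c by (simp flip: diff_divide_distrib)
    then show ?thesis
      using abs_stein_solution_increment_le[OF \<nu> that, of A] c by (simp add: c_def)
  qed
  then have "\<bar>measure_pmf.expectation p (\<lambda>w. \<nu> * h (Suc w) - real w * h w)\<bar> \<le> B"
    by (rule bound)
  moreover have "(\<lambda>w. \<nu> * h (Suc w) - real w * h w) =
      (\<lambda>w. (indicator A w - measure_pmf.prob (poisson_pmf \<nu>) A) / c)"
    unfolding stein_equation[OF \<nu>, symmetric] h_def by (simp add: diff_divide_distrib)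
  moreover have "measure_pmf.expectation p (\<lambda>w. indicator A w - measure_pmf.prob (poisson_pmf \<nu>) A)
      = measure_pmf.prob p A - measure_pmf.prob (poisson_pmf \<nu>) A"
    by (subst Bochner_Integration.integral_diff)
      (auto intro!: measure_pmf.integrable_const_bound[where B = 1])
  ultimately show "\<bar>measure_pmf.prob p A - measure_pmf.prob (poisson_pmf \<nu>) A\<bar> \<le> min 1 (inverse \<nu>) * B"
    unfolding c_def[symmetric] using c by (simp add: field_simps)
qed

section \<open>Continuity of the Poisson distribution in its rate\<close>

lemma pmf_poisson_dist:
  assumes "r \<ge> 0"
  shows "pmf (poisson_dist r) k = r ^ k / fact k * exp (- r)"
  using assms by (cases "r = 0"; cases "k = 0") (auto simp: poisson_dist_def)

lemma prob_ge_if_pmf_ge: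
  assumes "\<And>x. c * pmf p x \<le> pmf q x" "c \<ge> 0"
  shows "c * measure_pmf.prob p A \<le> measure_pmf.prob q A"
proof -
  have "c * measure_pmf.prob p A = infsetsum (\<lambda>x. c * pmf p x) A"
    by (simp add: measure_pmf_conv_infsetsum infsetsum_cmult_right pmf_abs_summable)
  also have "\<dots> \<le> infsetsum (pmf q) A"
    by (intro infsetsum_mono abs_summable_on_cmult_right pmf_abs_summable assms)
  finally show ?thesis by (simp add: measure_pmf_conv_infsetsum)
qed

text \<open>
  Pointwise, the mass function at rate \<open>b\<close> is at least \<open>e\<^sup>a\<^sup>-\<^sup>b\<close> times the one at rate \<open>a\<close>. Used for a set and for
  its complement, this bounds the difference of probabilities by \<open>1 - e\<^sup>a\<^sup>-\<^sup>b \<le> b - a\<close> in both directions.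
  The rate \<open>a = 0\<close> is included.
\<close>

lemma d_TV_poisson_dist_mono:
  assumes "0 \<le> a" "a \<le> b"
  shows "d_TV (poisson_dist a) (poisson_dist b) \<le> b - a" (is "d_TV ?p ?q \<le> _")
proof (rule d_TV_le)
  fix A
  have "exp (a - b) * pmf ?p k \<le> pmf ?q k" for k
    using assms by (auto simp: pmf_poisson_dist exp_diff exp_minus field_simps power_mono)
  then have lower: "exp (a - b) * measure_pmf.prob ?p A \<le> measure_pmf.prob ?q A" for A
    by (rule prob_ge_if_pmf_ge) simp
  have diff: "measure_pmf.prob ?p A - measure_pmf.prob ?q A \<le> b - a" for A
  proof -
    have "(1 - exp (a - b)) * measure_pmf.prob ?p A \<le> (1 - exp (a - b)) * 1"
      using assms by (intro mult_left_mono) auto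
    also have "\<dots> \<le> b - a" using exp_ge_add_one_self[of "a - b"] unfolding mult_1_right by linarith
    finally show ?thesis using lower[of A] by (simp add: algebra_simps)
  qed
  show "\<bar>measure_pmf.prob ?p A - measure_pmf.prob ?q A\<bar> \<le> b - a"
    using diff[of A] diff[of "- A"] measure_pmf.prob_compl[of A ?p] measure_pmf.prob_compl[of A ?q]
    by (simp add: Compl_eq_Diff_UNIV)
qed

lemma d_TV_commute: "d_TV p q = d_TV q p"
  by (simp add: d_TV_def abs_minus_commute)

lemma d_TV_poisson_dist_le:
  assumes "0 \<le> a" "0 \<le> b"
  shows "d_TV (poisson_dist a) (poisson_dist b) \<le> \<bar>a - b\<bar>"
proof (cases "a \<le> b")
  case True
  then show ?thesis using d_TV_poisson_dist_mono[of a b] assms by simp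
next
  case False
  then show ?thesis using d_TV_poisson_dist_mono[of b a] assms by (simp add: d_TV_commute)
qed

section \<open>Blocks of a composition\<close>

lemma sum_list_take_mono:
  fixes xs :: "nat list"
  assumes "a \<le> b"
  shows "sum_list (take a xs) \<le> sum_list (take b xs)"
  using assms by (auto simp: le_iff_add take_add)

lemma card_block: "i < length xs \<Longrightarrow> card (block xs i) = xs ! i"
  by (simp add: block_def take_Suc_conv_app_nth)

lemma finite_block [simp]: "finite (block xs i)"
  by (simp add: block_def)

lemma block_subset: "block xs i \<subseteq> {1..sum_list xs}"
  using sum_list_take_mono[of "Suc i" "max (Suc i) (length xs)" xs] by (auto simp: block_def)

lemma block_unique:
  assumes "x \<in> block xs i" "x \<in> block xs j"
  shows "i = j"
proof (rule ccontr)
  assume "i \<noteq> j"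
  then consider "Suc i \<le> j" | "Suc j \<le> i" by linarith
  then show False
    using assms sum_list_take_mono[of "Suc i" j xs] sum_list_take_mono[of "Suc j" i xs]
    by cases (auto simp: block_def)
qed

lemma exists_block:
  assumes "x \<in> {1..sum_list xs}"
  shows "\<exists>i<length xs. x \<in> block xs i"
proof -
  define m where "m = (LEAST m. x \<le> sum_list (take m xs))"
  have "x \<le> sum_list (take (length xs) xs)" using assms by simp
  then have m: "x \<le> sum_list (take m xs)" "m \<le> length xs"
    unfolding m_def by (rule LeastI, rule Least_le)
  have "m \<noteq> 0" using m assms by (intro notI) simp
  then obtain i where i: "m = Suc i" by (cases m) auto
  have "\<not> x \<le> sum_list (take i xs)"
    using not_less_Least[of i "\<lambda>m. x \<le> sum_list (take m xs)"] i by (simp add: m_def)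
  then show ?thesis
    using m i by (intro exI[of _ i]) (auto simp: block_def)
qed

lemma transpose_mem_iff: "(a \<in> S \<longleftrightarrow> b \<in> S) \<Longrightarrow> Transposition.transpose a b x \<in> S \<longleftrightarrow> x \<in> S"
  by (auto simp: Transposition.transpose_def)

section \<open>Existence of a permutation with a given table\<close>

lemma exists_colouring:
  fixes t :: "nat \<Rightarrow> nat"
  assumes "finite S" "card S = (\<Sum>j<m. t j)"
  shows "\<exists>c. (\<forall>x\<in>S. c x < m) \<and> (\<forall>j<m. card {x \<in> S. c x = j} = t j)"
  using assms
proof (induction m arbitrary: S)
  case 0
  then show ?case by simp
next
  case (Suc m)
  have "t m \<le> card S" using Suc.prems by simp
  then obtain U where U: "U \<subseteq> S" "card U = t m" "finite U"
    by (rule obtain_subset_with_card_n)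
  have "card (S - U) = (\<Sum>j<m. t j)"
    using Suc.prems U by (simp add: card_Diff_subset)
  then obtain c where c: "\<forall>x\<in>S - U. c x < m" "\<forall>j<m. card {x \<in> S - U. c x = j} = t j"
    using Suc.IH[of "S - U"] Suc.prems by auto
  define c' where "c' x = (if x \<in> U then m else c x)" for x
  have "{x \<in> S. c' x = m} = U"
    using U c(1) by (force simp: c'_def)
  moreover have "{x \<in> S. c' x = j} = {x \<in> S - U. c x = j}" if "j < m" for j
    using that by (auto simp: c'_def)
  moreover have "\<forall>x\<in>S. c' x < Suc m"
    using c(1) by (auto simp: c'_def less_Suc_eq)
  ultimately show ?case
    using c(2) U(2) by (intro exI[of _ c']) (auto simp: less_Suc_eq)
qed

text \<open>
  Cutting every row block \<open>i\<close> into pieces of sizes \<open>t i 0, t i 1, ...\<close> by one labelling of all points.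
\<close>

lemma exists_block_colouring:
  fixes t :: "nat \<Rightarrow> nat \<Rightarrow> nat"
  assumes sums: "\<And>i. i < length xs \<Longrightarrow> (\<Sum>j<m. t i j) = xs ! i"
  shows "\<exists>c. (\<forall>x\<in>{1..sum_list xs}. c x < m) \<and>
    (\<forall>i<length xs. \<forall>j<m. card {x \<in> block xs i. c x = j} = t i j)"
proof -
  have "\<forall>i\<in>{..<length xs}. \<exists>c. (\<forall>x\<in>block xs i. c x < m) \<and>
      (\<forall>j<m. card {x \<in> block xs i. c x = j} = t i j)"
  proof
    fix i assume "i \<in> {..<length xs}"
    then show "\<exists>c. (\<forall>x\<in>block xs i. c x < m) \<and> (\<forall>j<m. card {x \<in> block xs i. c x = j} = t i j)"
      by (intro exists_colouring[where t = "t i"]) (simp_all add: card_block sums)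
  qed
  then obtain c where c: "\<And>i x. i < length xs \<Longrightarrow> x \<in> block xs i \<Longrightarrow> c i x < m"
    "\<And>i j. i < length xs \<Longrightarrow> j < m \<Longrightarrow> card {x \<in> block xs i. c i x = j} = t i j"
    by (drule_tac bchoice) auto
  define b where "b x = (THE i. x \<in> block xs i)" for x
  have b: "b x = i" if "x \<in> block xs i" for x i
    unfolding b_def using that block_unique by blast
  have "c (b x) x < m" if x: "x \<in> {1..sum_list xs}" for x
  proof -
    obtain i where "i < length xs" "x \<in> block xs i" using exists_block[OF x] by blast
    then show ?thesis using b c(1) by simp
  qed
  moreover have "card {x \<in> block xs i. c (b x) x = j} = t i j" if "i < length xs" "j < m" for i j
  proof -
    have "{x \<in> block xs i. c (b x) x = j} = {x \<in> block xs i. c i x = j}"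
      using b by auto
    then show ?thesis using c(2)[OF that] by simp
  qed
  ultimately show ?thesis by (intro exI[of _ "\<lambda>x. c (b x) x"]) auto
qed

text \<open>
  Label each position by its row block and a prospective column, and each value by a prospective row
  and its column block, both with \<open>T\<^sub>i\<^sub>j\<close> points labelled \<open>(i, j)\<close>. The two labellings have the same multiset of
  labels, so some permutation carries one to the other, and its table is \<open>T\<close>.
\<close>

lemma double_coset_nonempty:
  assumes n: "sum_list lam = n" "sum_list mu = n" and margins: "has_margins lam mu T"
  shows "double_coset n lam mu T \<noteq> {}"
proof -
  have rows: "(\<Sum>j<length mu. T i j) = lam ! i" if "i < length lam" for i
    using margins that by (simp add: has_margins_def)
  have cols: "(\<Sum>i<length lam. T i j) = mu ! j" if "j < length mu" for j
    using margins that by (simp add: has_margins_def)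
  obtain c where c: "\<And>x. x \<in> {1..n} \<Longrightarrow> c x < length mu"
    "\<And>i j. i < length lam \<Longrightarrow> j < length mu \<Longrightarrow> card {x \<in> block lam i. c x = j} = T i j"
    using exists_block_colouring[where xs = lam and m = "length mu" and t = T, OF rows] unfolding n by metis
  obtain d where d: "\<And>x. x \<in> {1..n} \<Longrightarrow> d x < length lam"
    "\<And>i j. i < length lam \<Longrightarrow> j < length mu \<Longrightarrow> card {x \<in> block mu j. d x = i} = T i j"
    using exists_block_colouring[where xs = mu and m = "length lam" and t = "\<lambda>j i. T i j", OF cols] unfolding n by metis
  define r where "r x = (THE i. x \<in> block lam i)" for x
  define s where "s x = (THE j. x \<in> block mu j)" for x
  have r: "r x = i \<longleftrightarrow> x \<in> block lam i" if x: "x \<in> {1..n}" for x i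
  proof -
    obtain i' where "x \<in> block lam i'" using exists_block[of x lam] x unfolding n by blast
    moreover from this have "r x = i'"
      unfolding r_def using block_unique by blast
    ultimately show ?thesis using block_unique by blast
  qed
  have s: "s x = j \<longleftrightarrow> x \<in> block mu j" if x: "x \<in> {1..n}" for x j
  proof -
    obtain j' where "x \<in> block mu j'" using exists_block[of x mu] x unfolding n by blast
    moreover from this have "s x = j'"
      unfolding s_def using block_unique by blast
    ultimately show ?thesis using block_unique by blast
  qed
  have r_less: "r x < length lam" if x: "x \<in> {1..n}" for x
  proof -
    obtain i where "i < length lam" "x \<in> block lam i" using exists_block[of x lam] x unfolding n by blast
    then show ?thesis using r[OF x, of i] by simp
  qed
  have s_less: "s x < length mu" if x: "x \<in> {1..n}" for x
  proof -
    obtain i where "i < length mu" "x \<in> block mu i" using exists_block[of x mu] x unfolding n by blast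
    then show ?thesis using s[OF x, of i] by simp
  qed
  have "image_mset (\<lambda>x. (r x, c x)) (mset_set {1..n}) = image_mset (\<lambda>x. (d x, s x)) (mset_set {1..n})"
  proof (rule multiset_eqI)
    fix y :: "nat \<times> nat"
    obtain i j where y: "y = (i, j)" by (cases y)
    have 1: "count (image_mset f (mset_set {1..n})) y = card {x \<in> {1..n}. f x = y}" for f :: "nat \<Rightarrow> nat \<times> nat"
      by (auto simp: count_image_mset intro!: arg_cong[where f = card])
    have 2: "{x \<in> {1..n}. (r x, c x) = y} = {x \<in> block lam i. c x = j}"
      using r block_subset[of lam i] n by (auto simp: y)
    have 3: "{x \<in> {1..n}. (d x, s x) = y} = {x \<in> block mu j. d x = i}"
      using s block_subset[of mu j] n by (auto simp: y)
    show "count (image_mset (\<lambda>x. (r x, c x)) (mset_set {1..n})) y =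
      count (image_mset (\<lambda>x. (d x, s x)) (mset_set {1..n})) y"
    proof (cases "i < length lam \<and> j < length mu")
      case True
      then show ?thesis unfolding 1 2 3 using c(2) d(2) by simp
    next
      case False
      then have "{x \<in> {1..n}. (r x, c x) = y} = {}" "{x \<in> {1..n}. (d x, s x) = y} = {}"
        using r_less s_less c(1) d(1) by (auto simp: y)
      then show ?thesis unfolding 1 by (simp only:)
    qed
  qed
  then obtain \<sigma> where \<sigma>: "\<sigma> permutes {1..n}" and eq: "\<forall>x\<in>{1..n}. (r x, c x) = (d (\<sigma> x), s (\<sigma> x))"
    by (rule image_mset_eq_implies_permutes[rotated]) auto
  have "table lam mu \<sigma> i j = T i j" if "i < length lam" "j < length mu" for i j
  proof -
    have "{p \<in> block lam i. \<sigma> p \<in> block mu j} = {p \<in> block lam i. c p = j}"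
    proof (rule Collect_cong, rule conj_cong)
      fix p assume "p \<in> block lam i"
      then have p: "p \<in> {1..n}" using block_subset n by blast
      then have "\<sigma> p \<in> {1..n}" using permutes_in_image[OF \<sigma>] by blast
      then show "\<sigma> p \<in> block mu j \<longleftrightarrow> c p = j" using s eq p by auto
    qed simp
    then show ?thesis using c(2)[OF that] by (simp add: table_def)
  qed
  then show ?thesis using \<sigma> unfolding double_coset_def by blast
qed

section \<open>Counting the nonempty cells\<close>

lemma A_cell_unique:
  assumes "x \<in> A_cell lam mu k l" "x \<in> A_cell lam mu k' l'"
  shows "k = k' \<and> l = l'"
  using assms block_unique by (auto simp: A_cell_def)

definition nonempty_cells :: "nat list \<Rightarrow> nat list \<Rightarrow> (nat \<times> nat) set" where
  "nonempty_cells lam mu = {(k, l). k < length lam \<and> l < length mu \<and> A_cell lam mu k l \<noteq> {}}"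

lemma finite_nonempty_cells: "finite (nonempty_cells lam mu)"
  by (rule finite_subset[of _ "{..<length lam} \<times> {..<length mu}"]) (auto simp: nonempty_cells_def)

lemma finite_A_cell [simp]: "finite (A_cell lam mu k l)"
  by (simp add: A_cell_def)

lemma sum_over_cells:
  assumes n: "sum_list lam = n" "sum_list mu = n"
  shows "(\<Sum>x\<in>{1..n}. f x) = (\<Sum>(k, l)\<in>nonempty_cells lam mu. \<Sum>x\<in>A_cell lam mu k l. f x)"
proof -
  have "{1..n} = (\<Union>z\<in>nonempty_cells lam mu. case z of (k, l) \<Rightarrow> A_cell lam mu k l)"
  proof (intro equalityI subsetI)
    fix x assume x: "x \<in> {1..n}"
    obtain k where k: "k < length lam" "x \<in> block lam k" using exists_block[of x lam] x unfolding n by blast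
    obtain l where l: "l < length mu" "x \<in> block mu l" using exists_block[of x mu] x unfolding n by blast
    show "x \<in> (\<Union>z\<in>nonempty_cells lam mu. case z of (k, l) \<Rightarrow> A_cell lam mu k l)"
      using k l by (auto simp: nonempty_cells_def A_cell_def)
  next
    fix x assume "x \<in> (\<Union>z\<in>nonempty_cells lam mu. case z of (k, l) \<Rightarrow> A_cell lam mu k l)"
    then show "x \<in> {1..n}" using block_subset n by (force simp: A_cell_def)
  qed
  then have "(\<Sum>x\<in>{1..n}. f x) =
      (\<Sum>x\<in>(\<Union>z\<in>nonempty_cells lam mu. case z of (k, l) \<Rightarrow> A_cell lam mu k l). f x)" by simp
  also have "\<dots> = (\<Sum>z\<in>nonempty_cells lam mu. \<Sum>x\<in>(case z of (k, l) \<Rightarrow> A_cell lam mu k l). f x)"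
    by (rule sum.UNION_disjoint)
      (auto simp: finite_nonempty_cells split: prod.splits dest: A_cell_unique)
  also have "\<dots> = (\<Sum>(k, l)\<in>nonempty_cells lam mu. \<Sum>x\<in>A_cell lam mu k l. f x)"
    by (rule sum.cong) auto
  finally show ?thesis .
qed

text \<open>
  A nonempty cell is an intersection of two intervals, hence its largest element is the end of a row
  block or of a column block. Cells are disjoint, so this element determines the cell, and the last
  row block and the last column block have the same end \<open>n\<close>.
\<close>

lemma card_nonempty_cells:
  assumes n: "sum_list lam = n" "sum_list mu = n" "n \<ge> 1"
  shows "card (nonempty_cells lam mu) + 1 \<le> length lam + length mu"
proof -
  define e where "e k = sum_list (take (Suc k) lam)" for k
  define f where "f l = sum_list (take (Suc l) mu)" for l
  define \<phi> where "\<phi> = (\<lambda>(k, l). min (e k) (f l))"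
  obtain I where I: "length lam = Suc I" using n by (cases lam) auto
  obtain J where J: "length mu = Suc J" using n by (cases mu) auto
  have mem: "\<phi> (k, l) \<in> A_cell lam mu k l" if "(k, l) \<in> nonempty_cells lam mu" for k l
    using that by (auto simp: nonempty_cells_def A_cell_def block_def \<phi>_def e_def f_def)
  \<comment> \<open>\<open>\<phi> (k, l)\<close> is the largest element of the cell \<open>(k, l)\<close>\<close>
  have inj: "inj_on \<phi> (nonempty_cells lam mu)"
    using mem by (intro inj_onI) (metis A_cell_unique surj_pair)
  have "\<phi> ` nonempty_cells lam mu \<subseteq> e ` {..<I} \<union> f ` {..<Suc J}"
  proof
    fix y assume "y \<in> \<phi> ` nonempty_cells lam mu"
    then obtain k l where y: "y = min (e k) (f l)" "k \<le> I" "l \<le> J"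
      by (auto simp: \<phi>_def nonempty_cells_def I J less_Suc_eq_le)
    have "e I = n" "f J = n" using n I J by (auto simp: e_def f_def)
    moreover have "f l \<le> n" using sum_list_take_mono[of "Suc l" "length mu" mu] y J n by (simp add: f_def)
    ultimately show "y \<in> e ` {..<I} \<union> f ` {..<Suc J}"
      using y by (cases "k = I") (auto simp: min_def less_Suc_eq_le)
  qed
  then have "card (\<phi> ` nonempty_cells lam mu) \<le> card (e ` {..<I} \<union> f ` {..<Suc J})"
    by (intro card_mono) auto
  also have "\<dots> \<le> I + Suc J"
    by (rule order_trans[OF card_Un_le]) (metis add_mono card_image_le card_lessThan finite_lessThan)
  finally show ?thesis using I J inj by (simp add: card_image)
qed

section \<open>Creating a fixed point by two exchanges\<close>

abbreviation swap :: "nat \<Rightarrow> nat \<Rightarrow> nat \<Rightarrow> nat" where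
  "swap \<equiv> Transposition.transpose"

text \<open>
  First the entries in positions \<open>i\<close> and \<open>j\<close> are exchanged, which puts \<open>\<sigma> j\<close> in position \<open>i\<close>; then the
  values \<open>i\<close> and \<open>\<sigma> j\<close> are exchanged.
\<close>

definition graft :: "nat \<Rightarrow> nat \<Rightarrow> (nat \<Rightarrow> nat) \<Rightarrow> nat \<Rightarrow> nat" where
  "graft i j \<sigma> = swap i (\<sigma> j) \<circ> \<sigma> \<circ> swap i j"

lemma graft_fixes: "graft i j \<sigma> i = i"
  by (simp add: graft_def)

text \<open>
  Besides \<open>i\<close>, only \<open>j\<close> can lose its fixedness: a fixed point other than \<open>i\<close> and \<open>j\<close> has a value
  different from \<open>i\<close> and \<open>\<sigma> j\<close>. New fixed points other than \<open>i\<close> are \<open>j\<close>, if it receives \<open>\<sigma> i = j\<close>, and the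
  old position of the value \<open>i\<close>, which receives \<open>\<sigma> j\<close>.
\<close>

lemma fp_graft:
  assumes \<sigma>: "\<sigma> permutes {1..n}" and i: "i \<in> {1..n}"
  shows "\<bar>(real (fp n \<sigma>) + 1) - real (fp n (graft i j \<sigma>))\<bar>
    \<le> of_bool (\<sigma> i = i) + of_bool (\<sigma> j = j) + of_bool (\<sigma> i = j) + of_bool (\<sigma> (\<sigma> j) = i)"
proof -
  define F where "F \<tau> = {x \<in> {1..n}. \<tau> x = x}" for \<tau> :: "nat \<Rightarrow> nat"
  have fin [simp]: "finite (F \<tau>)" for \<tau> by (simp add: F_def)
  have inj: "\<sigma> x = \<sigma> y \<longleftrightarrow> x = y" for x y
    using permutes_inj[OF \<sigma>] by (auto dest: injD)
  have iF: "i \<in> F (graft i j \<sigma>)"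
    using i by (simp add: F_def graft_fixes)
  have card_if: "card (A \<union> (if P then {x} else {})) \<le> card A + of_bool P" for P A and x :: nat
    using card_Un_le[of A "{x}"] by (cases P) simp_all
  have "F \<sigma> \<subseteq> (F (graft i j \<sigma>) - {i}) \<union> (if \<sigma> i = i then {i} else {}) \<union> (if \<sigma> j = j then {j} else {})"
  proof
    fix p assume p: "p \<in> F \<sigma>"
    show "p \<in> (F (graft i j \<sigma>) - {i}) \<union> (if \<sigma> i = i then {i} else {}) \<union> (if \<sigma> j = j then {j} else {})"
    proof (cases "p = i \<or> p = j")
      case True
      then show ?thesis using p by (auto simp: F_def)
    next
      case False
      then have "\<sigma> p = p" "p \<noteq> \<sigma> j" using p inj[of p j] by (auto simp: F_def)
      then have "graft i j \<sigma> p = p" using False by (simp add: graft_def)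
      then show ?thesis using p False by (simp add: F_def)
    qed
  qed
  then have "card (F \<sigma>) \<le> card ((F (graft i j \<sigma>) - {i}) \<union> (if \<sigma> i = i then {i} else {}) \<union> (if \<sigma> j = j then {j} else {}))"
    by (intro card_mono) auto
  also have "\<dots> \<le> card (F (graft i j \<sigma>) - {i}) + of_bool (\<sigma> i = i) + of_bool (\<sigma> j = j)"
    using card_if[of "F (graft i j \<sigma>) - {i}" "\<sigma> i = i" i]
      card_if[of "(F (graft i j \<sigma>) - {i}) \<union> (if \<sigma> i = i then {i} else {})" "\<sigma> j = j" j]
    by linarith
  also have "card (F (graft i j \<sigma>) - {i}) = card (F (graft i j \<sigma>)) - 1"
    using iF by simp
  finally have "card (F \<sigma>) \<le> card (F (graft i j \<sigma>)) - 1 + of_bool (\<sigma> i = i) + of_bool (\<sigma> j = j)" .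
  moreover have "card (F (graft i j \<sigma>)) > 0"
    using iF by (auto simp: card_gt_0_iff)
  ultimately have "card (F \<sigma>) + 1 \<le> card (F (graft i j \<sigma>)) + of_bool (\<sigma> i = i) + of_bool (\<sigma> j = j)"
    by linarith
  then have "real (card (F \<sigma>) + 1) \<le>
      real (card (F (graft i j \<sigma>)) + of_bool (\<sigma> i = i) + of_bool (\<sigma> j = j))"
    by (rule of_nat_mono)
  then have up: "real (card (F \<sigma>)) + 1 \<le> real (card (F (graft i j \<sigma>))) + of_bool (\<sigma> i = i) + of_bool (\<sigma> j = j)"
    by simp
  have "F (graft i j \<sigma>) \<subseteq> F \<sigma> \<union> {i} \<union> (if \<sigma> i = j then {j} else {}) \<union> (if \<sigma> (\<sigma> j) = i then {\<sigma> j} else {})"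
  proof
    fix p assume p: "p \<in> F (graft i j \<sigma>)"
    then have fx: "swap i (\<sigma> j) (\<sigma> (swap i j p)) = p" "p \<in> {1..n}"
      by (auto simp: F_def graft_def)
    show "p \<in> F \<sigma> \<union> {i} \<union> (if \<sigma> i = j then {j} else {}) \<union> (if \<sigma> (\<sigma> j) = i then {\<sigma> j} else {})"
    proof (cases "p = i \<or> \<sigma> p = p")
      case True
      then show ?thesis using fx by (auto simp: F_def)
    next
      case False
      consider "p = j" | "p \<noteq> j" by blast
      then show ?thesis
      proof cases
        case 1
        then have *: "swap i (\<sigma> j) (\<sigma> i) = j" "j \<noteq> i" "\<sigma> j \<noteq> j"
          using fx False by auto
        then have "\<sigma> i = j"
          using inj[of i j] by (cases "\<sigma> i = i") (auto simp: Transposition.transpose_def split: if_splits)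
        then show ?thesis using 1 by simp
      next
        case 2
        then have *: "swap i (\<sigma> j) (\<sigma> p) = p" "\<sigma> p \<noteq> p" "\<sigma> p \<noteq> \<sigma> j"
          using fx False inj[of p j] by auto
        then have "\<sigma> p = i" "p = \<sigma> j"
          by (auto simp: Transposition.transpose_def split: if_splits)
        then show ?thesis by simp
      qed
    qed
  qed
  then have "card (F (graft i j \<sigma>)) \<le> card (F \<sigma> \<union> {i} \<union> (if \<sigma> i = j then {j} else {}) \<union> (if \<sigma> (\<sigma> j) = i then {\<sigma> j} else {}))"
    by (intro card_mono) auto
  also have "\<dots> \<le> card (F \<sigma>) + card {i} + of_bool (\<sigma> i = j) + of_bool (\<sigma> (\<sigma> j) = i)"
    using card_Un_le[of "F \<sigma>" "{i}"] card_if[of "F \<sigma> \<union> {i}" "\<sigma> i = j" j]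
      card_if[of "F \<sigma> \<union> {i} \<union> (if \<sigma> i = j then {j} else {})" "\<sigma> (\<sigma> j) = i" "\<sigma> j"]
    by linarith
  finally have "real (card (F (graft i j \<sigma>))) \<le>
      real (card (F \<sigma>) + card {i} + of_bool (\<sigma> i = j) + of_bool (\<sigma> (\<sigma> j) = i))"
    by (rule of_nat_mono)
  then have "real (card (F (graft i j \<sigma>))) \<le> real (card (F \<sigma>)) + 1 + of_bool (\<sigma> i = j) + of_bool (\<sigma> (\<sigma> j) = i)"
    by simp
  then show ?thesis
    using up unfolding fp_def F_def[symmetric] abs_le_iff
    by (smt (verit) of_bool_def)
qed

lemma abs_diff_le_of_unit_increments:
  fixes h :: "nat \<Rightarrow> real"
  assumes h: "\<And>k. k \<ge> 1 \<Longrightarrow> \<bar>h (Suc k) - h k\<bar> \<le> 1" and "x \<ge> 1" "y \<ge> 1"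
  shows "\<bar>h x - h y\<bar> \<le> \<bar>real x - real y\<bar>"
proof -
  have *: "\<bar>h y - h x\<bar> \<le> real y - real x" if "x \<le> y" "x \<ge> 1" for x y
    using that(1)
  proof (induction y rule: dec_induct)
    case base
    then show ?case by simp
  next
    case (step m)
    then show ?case using h[of m] that(2) by simp
  qed
  show ?thesis
    using *[of x y] *[of y x] assms(2,3) by linarith
qed

section \<open>The size-bias coupling on a double coset\<close>

text \<open>
  Every \<open>j\<close> is counted for at most one \<open>i\<close>.
\<close>

lemma sum_of_bool_eq_le:
  assumes "finite A" "finite B"
  shows "(\<Sum>i\<in>B. \<Sum>j\<in>A. of_bool (f j = i)) \<le> real (card A)"
proof -
  have "(\<Sum>i\<in>B. \<Sum>j\<in>A. of_bool (f j = i)) = (\<Sum>j\<in>A. \<Sum>i\<in>B. of_bool (f j = i) :: real)"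
    by (rule sum.swap)
  also have "\<dots> \<le> (\<Sum>j\<in>A. 1)"
    using assms by (intro sum_mono) (simp add: of_bool_def sum.delta)
  finally show ?thesis by simp
qed

locale contingency =
  fixes n :: nat and lam mu :: "nat list" and T :: "nat \<Rightarrow> nat \<Rightarrow> nat"
  assumes sum_lam: "sum_list lam = n" and sum_mu: "sum_list mu = n"
    and margins: "has_margins lam mu T"
begin

abbreviation D :: "(nat \<Rightarrow> nat) set" where
  "D \<equiv> double_coset n lam mu T"

definition choices :: "nat \<Rightarrow> nat \<Rightarrow> (nat \<Rightarrow> nat) \<Rightarrow> nat set" where
  "choices k l \<sigma> = {j \<in> block lam k. \<sigma> j \<in> block mu l}"

lemma finite_choices [simp]: "finite (choices k l \<sigma>)"
  by (simp add: choices_def)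

lemma finite_D: "finite D"
  by (rule finite_subset[OF _ finite_permutations[of "{1..n}"]]) (auto simp: double_coset_def)

lemma D_nonempty: "D \<noteq> {}"
  by (rule double_coset_nonempty[OF sum_lam sum_mu margins])

lemma card_D_pos: "real (card D) > 0"
  using finite_D D_nonempty by (simp add: card_gt_0_iff)

lemma permutes_D: "\<sigma> \<in> D \<Longrightarrow> \<sigma> permutes {1..n}"
  by (simp add: double_coset_def)

lemma card_choices:
  assumes "\<sigma> \<in> D" "k < length lam" "l < length mu"
  shows "card (choices k l \<sigma>) = T k l"
  using assms by (simp add: double_coset_def table_def choices_def)

text \<open>
  This is the invariance of the double coset under \<open>S\<^sub>\<lambda>\<close> and \<open>S\<^sub>\<mu>\<close>, for the transpositions.
\<close>

lemma transpose_comp_mem_D: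
  assumes \<sigma>: "\<sigma> \<in> D" and ab: "a \<in> block mu l" "b \<in> block mu l"
    and cd: "c \<in> block lam k" "d \<in> block lam k"
  shows "swap a b \<circ> \<sigma> \<circ> swap c d \<in> D" (is "?\<tau> \<in> D")
proof -
  have n: "a \<in> {1..n}" "b \<in> {1..n}" "c \<in> {1..n}" "d \<in> {1..n}"
    using ab cd block_subset[of lam k, unfolded sum_lam] block_subset[of mu l, unfolded sum_mu]
    by (auto dest: subsetD)
  have "?\<tau> permutes {1..n}"
    using permutes_D[OF \<sigma>] n by (intro permutes_compose permutes_swap_id) auto
  moreover have "table lam mu ?\<tau> i j = table lam mu \<sigma> i j" for i j
  proof -
    have row: "swap c d x \<in> block lam i \<longleftrightarrow> x \<in> block lam i" for x
      by (rule transpose_mem_iff) (use cd block_unique[of c lam k i] block_unique[of d lam k i] in auto)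
    have col: "swap a b x \<in> block mu j \<longleftrightarrow> x \<in> block mu j" for x
      by (rule transpose_mem_iff) (use ab block_unique[of a mu l j] block_unique[of b mu l j] in auto)
    have "bij_betw (swap c d)
        {p \<in> block lam i. ?\<tau> p \<in> block mu j} {p \<in> block lam i. \<sigma> p \<in> block mu j}"
      by (rule bij_betw_byWitness[where f' = "swap c d"]) (auto simp: row col)
    then show ?thesis unfolding table_def by (rule bij_betw_same_card)
  qed
  ultimately show ?thesis using \<sigma> by (simp add: double_coset_def)
qed

text \<open>
  Undoing the surgery requires knowing the two exchanges, that is, \<open>j \<in> L\<^sub>k\<close> and \<open>v = \<sigma> j \<in> M\<^sub>l\<close>; and from
  any \<open>\<tau> \<in> D\<close> fixing \<open>i\<close>, every such \<open>j\<close> and \<open>v\<close> is possible. So \<open>(\<sigma>, j)\<close> corresponds bijectively to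
  \<open>(\<tau>, j, v)\<close>: the surgery hits each \<open>\<tau>\<close> equally often.
\<close>

lemma sum_graft:
  fixes g :: "(nat \<Rightarrow> nat) \<Rightarrow> real"
  assumes k: "k < length lam" and l: "l < length mu" and i: "i \<in> A_cell lam mu k l"
  shows "(\<Sum>\<sigma>\<in>D. \<Sum>j\<in>choices k l \<sigma>. g (graft i j \<sigma>))
    = real (lam ! k * mu ! l) * (\<Sum>\<tau> | \<tau> \<in> D \<and> \<tau> i = i. g \<tau>)"
proof -
  have i': "i \<in> block lam k" "i \<in> block mu l" using i by (auto simp: A_cell_def)
  have "(\<Sum>\<sigma>\<in>D. \<Sum>j\<in>choices k l \<sigma>. g (graft i j \<sigma>))
      = (\<Sum>(\<sigma>, j)\<in>Sigma D (choices k l). g (graft i j \<sigma>))"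
    by (rule sum.Sigma) (auto simp: finite_D)
  also have "\<dots> = (\<Sum>(\<tau>, _)\<in>{\<tau> \<in> D. \<tau> i = i} \<times> (block lam k \<times> block mu l). g \<tau>)"
  proof (rule sum.reindex_bij_witness[where
        j = "\<lambda>(\<sigma>, j). (graft i j \<sigma>, (j, \<sigma> j))" and
        i = "\<lambda>(\<tau>, (j, v)). (swap i v \<circ> \<tau> \<circ> swap i j, j)"])
    fix z assume "z \<in> Sigma D (choices k l)"
    then obtain \<sigma> j where z: "z = (\<sigma>, j)" "\<sigma> \<in> D" "j \<in> block lam k" "\<sigma> j \<in> block mu l"
      by (auto simp: choices_def)
    then show "(case case z of (\<sigma>, j) \<Rightarrow> (graft i j \<sigma>, (j, \<sigma> j)) of
        (\<tau>, (j, v)) \<Rightarrow> (swap i v \<circ> \<tau> \<circ> swap i j, j)) = z"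
      by (auto simp: graft_def fun_eq_iff)
    have "graft i j \<sigma> \<in> D"
      unfolding graft_def using z i' by (intro transpose_comp_mem_D)
    then show "(case z of (\<sigma>, j) \<Rightarrow> (graft i j \<sigma>, (j, \<sigma> j))) \<in> {\<tau> \<in> D. \<tau> i = i} \<times> (block lam k \<times> block mu l)"
      using z by (auto simp: graft_fixes)
    show "(case case z of (\<sigma>, j) \<Rightarrow> (graft i j \<sigma>, (j, \<sigma> j)) of (\<tau>, _) \<Rightarrow> g \<tau>) = (case z of (\<sigma>, j) \<Rightarrow> g (graft i j \<sigma>))"
      by (simp add: z)
  next
    fix z assume "z \<in> {\<tau> \<in> D. \<tau> i = i} \<times> (block lam k \<times> block mu l)"
    then obtain \<tau> j v where z: "z = (\<tau>, (j, v))" "\<tau> \<in> D" "\<tau> i = i" "j \<in> block lam k" "v \<in> block mu l"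
      by auto
    have "swap i v \<circ> \<tau> \<circ> swap i j \<in> D"
      using z i' by (intro transpose_comp_mem_D)
    then show "(case z of (\<tau>, (j, v)) \<Rightarrow> (swap i v \<circ> \<tau> \<circ> swap i j, j)) \<in> Sigma D (choices k l)"
      using z by (auto simp: choices_def)
    show "(case case z of (\<tau>, (j, v)) \<Rightarrow> (swap i v \<circ> \<tau> \<circ> swap i j, j) of
        (\<sigma>, j) \<Rightarrow> (graft i j \<sigma>, (j, \<sigma> j))) = z"
      using z by (auto simp: graft_def fun_eq_iff)
  qed
  also have "\<dots> = (\<Sum>\<tau> | \<tau> \<in> D \<and> \<tau> i = i. \<Sum>_\<in>block lam k \<times> block mu l. g \<tau>)"
    by (rule sum.Sigma[symmetric]) (auto simp: finite_D)
  also have "\<dots> = real (lam ! k * mu ! l) * (\<Sum>\<tau> | \<tau> \<in> D \<and> \<tau> i = i. g \<tau>)"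
    by (simp add: card_cartesian_product card_block k l sum_distrib_left)
  finally show ?thesis .
qed

text \<open>
  That is, \<open>P(\<sigma> i = i) = T\<^sub>k\<^sub>l / (\<lambda>\<^sub>k \<mu>\<^sub>l)\<close>: take the constant function 1 in \<open>sum_graft\<close>.
\<close>

lemma card_fixing:
  assumes k: "k < length lam" and l: "l < length mu" and i: "i \<in> A_cell lam mu k l"
  shows "real (T k l) * real (card D) = real (lam ! k * mu ! l) * real (card {\<tau> \<in> D. \<tau> i = i})"
proof -
  have "real (T k l) * real (card D) = (\<Sum>\<sigma>\<in>D. \<Sum>j\<in>choices k l \<sigma>. 1)"
    by (simp add: card_choices k l)
  also have "\<dots> = real (lam ! k * mu ! l) * real (card {\<tau> \<in> D. \<tau> i = i})"
    by (subst sum_graft[OF assms]) simp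
  finally show ?thesis .
qed

lemma T_le:
  assumes "k < length lam" "l < length mu"
  shows "T k l \<le> lam ! k" "T k l \<le> mu ! l"
proof -
  have "T k l \<le> (\<Sum>j<length mu. T k j)" using assms by (intro member_le_sum) auto
  then show "T k l \<le> lam ! k" using margins assms by (simp add: has_margins_def)
  have "T k l \<le> (\<Sum>i<length lam. T i l)"
    using assms by (intro member_le_sum[where f = "\<lambda>i. T i l"]) auto
  then show "T k l \<le> mu ! l" using margins assms by (simp add: has_margins_def)
qed

lemma card_A_cell_le:
  assumes "k < length lam" "l < length mu"
  shows "card (A_cell lam mu k l) \<le> lam ! k" "card (A_cell lam mu k l) \<le> mu ! l"
  using assms card_mono[of "block lam k" "A_cell lam mu k l"] card_mono[of "block mu l" "A_cell lam mu k l"]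
  by (auto simp: A_cell_def card_block)

text \<open>
  Up to the factor \<open>T\<^sub>k\<^sub>l |D|\<close>, this is the expected distance between the two coupled variables.
\<close>

definition disturbance :: "nat \<Rightarrow> nat \<Rightarrow> nat \<Rightarrow> real" where
  "disturbance k l i =
     (\<Sum>\<sigma>\<in>D. \<Sum>j\<in>choices k l \<sigma>. \<bar>(real (fp n \<sigma>) + 1) - real (fp n (graft i j \<sigma>))\<bar>)"

text \<open>
  Each of the four indicators in \<open>fp_graft\<close> contributes at most \<open>m N\<close>, where \<open>m = min {\<lambda>\<^sub>k, \<mu>\<^sub>l}\<close> and \<open>N = |D|\<close>.
  For the first two this is the formula for \<open>P(\<sigma> i = i)\<close> together with \<open>|A\<^sub>k\<^sub>l| \<le> m\<close>, \<open>T\<^sub>k\<^sub>l \<le> m\<close> and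
  \<open>m\<^sup>2 \<le> \<lambda>\<^sub>k \<mu>\<^sub>l\<close>. For the last two, a pair \<open>(\<sigma>, j)\<close> leaves one candidate for \<open>i\<close>, so there are at most \<open>T\<^sub>k\<^sub>l N\<close>
  triples.
\<close>

lemma sum_disturbance_le:
  assumes k: "k < length lam" and l: "l < length mu"
  shows "(\<Sum>i\<in>A_cell lam mu k l. disturbance k l i) \<le> 4 * real (min (lam ! k) (mu ! l)) * real (card D)"
proof -
  let ?A = "A_cell lam mu k l"
  define a t w m N where "a = real (card ?A)" and "t = real (T k l)"
    and "w = real (lam ! k * mu ! l)" and "m = real (min (lam ! k) (mu ! l))" and "N = real (card D)"
  have am: "0 \<le> a" "a \<le> m" and tm: "0 \<le> t" "t \<le> m"
    using card_A_cell_le[OF k l] T_le[OF k l] by (auto simp: a_def t_def m_def)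
  have mw: "m * m \<le> w"
    unfolding m_def w_def of_nat_mult by (intro mult_mono) auto
  have N: "N \<ge> 0" and m: "m \<ge> 0" by (simp_all add: N_def m_def)
  have w: "w > 0" if "i \<in> ?A" for i
  proof -
    have "block lam k \<noteq> {}" "block mu l \<noteq> {}" using that by (auto simp: A_cell_def)
    then have "card (block lam k) > 0" "card (block mu l) > 0" by (simp_all add: card_gt_0_iff)
    then show ?thesis using k l by (simp add: w_def card_block)
  qed
  \<comment> \<open>Used with \<open>r = T\<^sub>k\<^sub>l\<close> for the indicator of \<open>\<sigma> i = i\<close> and with \<open>r = |A\<^sub>k\<^sub>l|\<close> for that of \<open>\<sigma> j = j\<close>.\<close>
  have fixing: "r * real (card {\<tau> \<in> D. \<tau> i = i}) \<le> N" if i: "i \<in> ?A" and r: "0 \<le> r" "r \<le> m" for i r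
  proof -
    have "r * t \<le> w" using mult_mono[OF r(2) tm(2)] m tm(1) mw by linarith
    then have "r * t * N \<le> w * N" using N by (rule mult_right_mono)
    moreover have "r * t * N = w * (r * real (card {\<tau> \<in> D. \<tau> i = i}))"
      using card_fixing[OF k l i] by (simp add: t_def N_def w_def)
    ultimately show ?thesis using w[OF i] by (simp add: mult_le_cancel_left)
  qed
  have card_ch: "real (card (choices k l \<sigma>)) = t" if "\<sigma> \<in> D" for \<sigma>
    using card_choices[OF that k l] by (simp add: t_def)
  have "(\<Sum>i\<in>?A. \<Sum>\<sigma>\<in>D. \<Sum>j\<in>choices k l \<sigma>. of_bool (\<sigma> i = i)) \<le> (\<Sum>i\<in>?A. N)"
  proof (rule sum_mono)
    fix i assume i: "i \<in> ?A"
    have "(\<Sum>\<sigma>\<in>D. \<Sum>j\<in>choices k l \<sigma>. of_bool (\<sigma> i = i)) = (\<Sum>\<sigma>\<in>D. t * of_bool (\<sigma> i = i))"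
      by (intro sum.cong) (simp_all add: card_ch)
    also have "\<dots> = t * real (card {\<tau> \<in> D. \<tau> i = i})"
      by (simp add: finite_D Int_def flip: sum_distrib_left)
    finally show "(\<Sum>\<sigma>\<in>D. \<Sum>j\<in>choices k l \<sigma>. of_bool (\<sigma> i = i)) \<le> N"
      using fixing[OF i tm] by simp
  qed
  then have 1: "(\<Sum>i\<in>?A. \<Sum>\<sigma>\<in>D. \<Sum>j\<in>choices k l \<sigma>. of_bool (\<sigma> i = i)) \<le> m * N"
    using mult_right_mono[OF am(2) N] by (simp add: a_def)
  have "(\<Sum>\<sigma>\<in>D. \<Sum>j\<in>choices k l \<sigma>. of_bool (\<sigma> j = j)) \<le> N" (is "?S \<le> _") if "?A \<noteq> {}"
  proof -
    have "(\<Sum>j\<in>choices k l \<sigma>. of_bool (\<sigma> j = j) :: real) = (\<Sum>j\<in>?A. of_bool (\<sigma> j = j))" for \<sigma>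
    proof -
      have "choices k l \<sigma> \<inter> {j. \<sigma> j = j} = ?A \<inter> {j. \<sigma> j = j}"
        by (auto simp: choices_def A_cell_def)
      then show ?thesis by simp
    qed
    then have "?S = (\<Sum>j\<in>?A. \<Sum>\<sigma>\<in>D. of_bool (\<sigma> j = j))"
      by (simp only:) (rule sum.swap)
    also have "\<dots> = (\<Sum>j\<in>?A. real (card {\<tau> \<in> D. \<tau> j = j}))"
      by (simp add: finite_D Int_def)
    finally have "a * ?S = (\<Sum>j\<in>?A. a * real (card {\<tau> \<in> D. \<tau> j = j}))"
      by (simp add: sum_distrib_left)
    also have "\<dots> \<le> (\<Sum>j\<in>?A. N)"
      by (intro sum_mono fixing am)
    finally have "a * ?S \<le> a * N" by (simp add: a_def)
    moreover have "a > 0" using that by (simp add: a_def card_gt_0_iff)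
    ultimately show ?thesis by (simp add: mult_le_cancel_left)
  qed
  then have "(\<Sum>i\<in>?A. \<Sum>\<sigma>\<in>D. \<Sum>j\<in>choices k l \<sigma>. of_bool (\<sigma> j = j)) \<le> (\<Sum>i\<in>?A. N)"
    by (intro sum_mono) blast
  then have 2: "(\<Sum>i\<in>?A. \<Sum>\<sigma>\<in>D. \<Sum>j\<in>choices k l \<sigma>. of_bool (\<sigma> j = j)) \<le> m * N"
    using mult_right_mono[OF am(2) N] by (simp add: a_def)
  have determined: "(\<Sum>i\<in>?A. \<Sum>\<sigma>\<in>D. \<Sum>j\<in>choices k l \<sigma>. of_bool (f \<sigma> j = i)) \<le> m * N"
    for f :: "(nat \<Rightarrow> nat) \<Rightarrow> nat \<Rightarrow> nat"
  proof -
    have "(\<Sum>i\<in>?A. \<Sum>\<sigma>\<in>D. \<Sum>j\<in>choices k l \<sigma>. of_bool (f \<sigma> j = i))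
        = (\<Sum>\<sigma>\<in>D. \<Sum>i\<in>?A. \<Sum>j\<in>choices k l \<sigma>. of_bool (f \<sigma> j = i) :: real)"
      by (rule sum.swap)
    also have "\<dots> \<le> (\<Sum>\<sigma>\<in>D. m)"
    proof (rule sum_mono)
      fix \<sigma> assume "\<sigma> \<in> D"
      then show "(\<Sum>i\<in>?A. \<Sum>j\<in>choices k l \<sigma>. of_bool (f \<sigma> j = i)) \<le> m"
        using sum_of_bool_eq_le[OF finite_choices[of k l \<sigma>] finite_A_cell[of lam mu k l], of "f \<sigma>"]
          card_ch[of \<sigma>] tm(2) by linarith
    qed
    finally show ?thesis by (simp add: N_def mult.commute)
  qed
  have "(\<Sum>i\<in>?A. \<Sum>\<sigma>\<in>D. \<Sum>j\<in>choices k l \<sigma>. of_bool (\<sigma> i = j) :: real)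
      = (\<Sum>i\<in>?A. \<Sum>\<sigma>\<in>D. \<Sum>j\<in>choices k l \<sigma>. of_bool (inv \<sigma> j = i))"
  proof (intro sum.cong refl arg_cong[where f = of_bool])
    fix i j \<sigma> assume "\<sigma> \<in> D"
    then show "\<sigma> i = j \<longleftrightarrow> inv \<sigma> j = i"
      using permutes_inv_eq[OF permutes_D, of \<sigma> j i] by auto
  qed
  then have 3: "(\<Sum>i\<in>?A. \<Sum>\<sigma>\<in>D. \<Sum>j\<in>choices k l \<sigma>. of_bool (\<sigma> i = j)) \<le> m * N"
    using determined[of inv] by simp
  have 4: "(\<Sum>i\<in>?A. \<Sum>\<sigma>\<in>D. \<Sum>j\<in>choices k l \<sigma>. of_bool (\<sigma> (\<sigma> j) = i)) \<le> m * N"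
    by (rule determined)
  have "(\<Sum>i\<in>?A. disturbance k l i) \<le> (\<Sum>i\<in>?A. \<Sum>\<sigma>\<in>D. \<Sum>j\<in>choices k l \<sigma>.
      of_bool (\<sigma> i = i) + of_bool (\<sigma> j = j) + of_bool (\<sigma> i = j) + of_bool (\<sigma> (\<sigma> j) = i))"
    unfolding disturbance_def
  proof (intro sum_mono fp_graft)
    fix i assume "i \<in> ?A"
    then show "i \<in> {1..n}" using block_subset[of lam k] sum_lam by (auto simp: A_cell_def)
  qed (rule permutes_D)
  also have "\<dots> \<le> m * N + m * N + m * N + m * N"
    unfolding sum.distrib by (intro add_mono 1 2 3 4)
  finally show ?thesis by (simp add: m_def N_def ac_simps)
qed

lemma fp_mean_eq: "fp_mean n lam mu T = (\<Sum>i\<in>{1..n}. real (card {\<tau> \<in> D. \<tau> i = i})) / real (card D)"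
proof -
  have "fp_mean n lam mu T = (\<Sum>\<sigma>\<in>D. real (fp n \<sigma>)) / real (card D)"
    unfolding fp_mean_def by (rule integral_pmf_of_set[OF D_nonempty finite_D])
  also have "(\<Sum>\<sigma>\<in>D. real (fp n \<sigma>)) = (\<Sum>\<sigma>\<in>D. \<Sum>i\<in>{1..n}. of_bool (\<sigma> i = i))"
    by (simp add: fp_def Int_def)
  also have "\<dots> = (\<Sum>i\<in>{1..n}. \<Sum>\<sigma>\<in>D. of_bool (\<sigma> i = i))"
    by (rule sum.swap)
  also have "\<dots> = (\<Sum>i\<in>{1..n}. real (card {\<tau> \<in> D. \<tau> i = i}))"
    by (simp add: finite_D Int_def)
  finally show ?thesis .
qed

text \<open>
  The point 1 lies in some cell, where \<open>T\<^sub>k\<^sub>l \<ge> 1\<close> makes it a fixed point with positive probability.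
\<close>

lemma fp_mean_pos:
  assumes "n \<ge> 1"
    and T: "\<forall>k<length lam. \<forall>l<length mu. A_cell lam mu k l \<noteq> {} \<longrightarrow> 1 \<le> T k l"
  shows "fp_mean n lam mu T > 0"
proof -
  have "1 \<in> {1..n}" using assms by simp
  then obtain k l where "k < length lam" "1 \<in> block lam k" "l < length mu" "1 \<in> block mu l"
    using exists_block[of 1 lam, unfolded sum_lam] exists_block[of 1 mu, unfolded sum_mu] by blast
  then have kl: "k < length lam" "l < length mu" "1 \<in> A_cell lam mu k l"
    by (simp_all add: A_cell_def)
  then have "1 \<le> T k l" using T by blast
  then have "0 < real (T k l) * real (card D)" using card_D_pos by simp
  also have "\<dots> = real (lam ! k * mu ! l) * real (card {\<tau> \<in> D. \<tau> 1 = 1})"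
    by (rule card_fixing[OF kl])
  finally have "0 < real (card {\<tau> \<in> D. \<tau> 1 = 1})"
    by (simp add: zero_less_mult_iff)
  also have "\<dots> \<le> (\<Sum>i\<in>{1..n}. real (card {\<tau> \<in> D. \<tau> i = i}))"
    using assms by (intro member_le_sum) auto
  finally show ?thesis
    unfolding fp_mean_eq using card_D_pos by simp
qed

text \<open>
  The point \<open>i\<close> contributes \<open>P(\<sigma> i = i) E h(W + 1) - E (1[\<sigma> i = i] h(W))\<close> to the mean of the Stein operator.
  By \<open>card_fixing\<close> and \<open>sum_graft\<close> both terms are averages over the same pairs \<open>(\<sigma>, j)\<close>, and can be
  compared termwise.
\<close>

lemma size_bias_defect_le:
  fixes h :: "nat \<Rightarrow> real"
  assumes h: "\<And>r. r \<ge> 1 \<Longrightarrow> \<bar>h (Suc r) - h r\<bar> \<le> 1"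
    and k: "k < length lam" and l: "l < length mu" and i: "i \<in> A_cell lam mu k l"
  shows "real (lam ! k * mu ! l) * \<bar>real (card {\<tau> \<in> D. \<tau> i = i}) / real (card D) * (\<Sum>\<sigma>\<in>D. h (Suc (fp n \<sigma>)))
      - (\<Sum>\<tau> | \<tau> \<in> D \<and> \<tau> i = i. h (fp n \<tau>))\<bar> \<le> disturbance k l i" (is "?w * \<bar>?c / ?N * ?H - ?G\<bar> \<le> _")
proof -
  have "?w * (?c / ?N * ?H - ?G) = real (T k l) * ?H - ?w * ?G"
    using card_fixing[OF k l i] card_D_pos by (simp add: field_simps)
  also have "real (T k l) * ?H = (\<Sum>\<sigma>\<in>D. \<Sum>j\<in>choices k l \<sigma>. h (Suc (fp n \<sigma>)))"
    by (simp add: sum_distrib_left card_choices k l)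
  also have "?w * ?G = (\<Sum>\<sigma>\<in>D. \<Sum>j\<in>choices k l \<sigma>. h (fp n (graft i j \<sigma>)))"
    by (rule sum_graft[OF k l i, symmetric])
  finally have "?w * (?c / ?N * ?H - ?G) =
      (\<Sum>\<sigma>\<in>D. \<Sum>j\<in>choices k l \<sigma>. h (Suc (fp n \<sigma>)) - h (fp n (graft i j \<sigma>)))"
    by (simp add: sum_subtractf)
  moreover have "?w * \<bar>?c / ?N * ?H - ?G\<bar> = \<bar>?w * (?c / ?N * ?H - ?G)\<bar>"
    by (simp only: abs_mult abs_of_nat)
  ultimately have "?w * \<bar>?c / ?N * ?H - ?G\<bar> =
      \<bar>\<Sum>\<sigma>\<in>D. \<Sum>j\<in>choices k l \<sigma>. h (Suc (fp n \<sigma>)) - h (fp n (graft i j \<sigma>))\<bar>"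
    by (simp only:)
  also have "\<dots> \<le> (\<Sum>\<sigma>\<in>D. \<Sum>j\<in>choices k l \<sigma>. \<bar>h (Suc (fp n \<sigma>)) - h (fp n (graft i j \<sigma>))\<bar>)"
    by (intro order_trans[OF sum_abs] sum_mono sum_abs)
  also have "\<dots> \<le> disturbance k l i"
    unfolding disturbance_def
  proof (intro sum_mono)
    fix \<sigma> j
    have "i \<in> {1..n}" using i block_subset[of lam k] sum_lam by (auto simp: A_cell_def)
    then have "i \<in> {x \<in> {1..n}. graft i j \<sigma> x = x}" by (simp add: graft_fixes)
    then have "fp n (graft i j \<sigma>) \<ge> 1"
      unfolding fp_def using card_gt_0_iff[of "{x \<in> {1..n}. graft i j \<sigma> x = x}"] by fastforce
    then show "\<bar>h (Suc (fp n \<sigma>)) - h (fp n (graft i j \<sigma>))\<bar> \<le> \<bar>(real (fp n \<sigma>) + 1) - real (fp n (graft i j \<sigma>))\<bar>"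
      using abs_diff_le_of_unit_increments[where h = h and x = "Suc (fp n \<sigma>)" and y = "fp n (graft i j \<sigma>)", OF h]
      by (simp add: add.commute)
  qed
  finally show ?thesis .
qed

lemma sum_size_bias_defect_le:
  fixes h :: "nat \<Rightarrow> real"
  assumes h: "\<And>r. r \<ge> 1 \<Longrightarrow> \<bar>h (Suc r) - h r\<bar> \<le> 1"
    and k: "k < length lam" and l: "l < length mu"
  shows "(\<Sum>i\<in>A_cell lam mu k l. \<bar>real (card {\<tau> \<in> D. \<tau> i = i}) / real (card D) * (\<Sum>\<sigma>\<in>D. h (Suc (fp n \<sigma>)))
      - (\<Sum>\<tau> | \<tau> \<in> D \<and> \<tau> i = i. h (fp n \<tau>))\<bar>) \<le> 4 * real (card D) / real (max (lam ! k) (mu ! l))"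
    (is "(\<Sum>i\<in>?A. ?dev i) \<le> _")
proof (cases "?A = {}")
  case True
  then show ?thesis by simp
next
  case False
  then have "block lam k \<noteq> {}" "block mu l \<noteq> {}" by (auto simp: A_cell_def)
  then have "card (block lam k) > 0" "card (block mu l) > 0" by (simp_all add: card_gt_0_iff)
  then have pos: "lam ! k > 0" "mu ! l > 0" using k l by (simp_all add: card_block)
  have "real (lam ! k * mu ! l) * (\<Sum>i\<in>?A. ?dev i) \<le> (\<Sum>i\<in>?A. disturbance k l i)"
    unfolding sum_distrib_left[of "real (lam ! k * mu ! l)"] by (intro sum_mono size_bias_defect_le h k l)
  also have "\<dots> \<le> 4 * real (min (lam ! k) (mu ! l)) * real (card D)"
    by (rule sum_disturbance_le[OF k l])
  finally have "(\<Sum>i\<in>?A. ?dev i) \<le> 4 * real (min (lam ! k) (mu ! l)) * real (card D) / real (lam ! k * mu ! l)"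
    using pos by (simp add: pos_le_divide_eq mult.commute)
  also have "\<dots> = 4 * real (card D) / real (max (lam ! k) (mu ! l))"
    using pos by (auto simp: min_def max_def field_simps)
  finally show ?thesis .
qed

text \<open>
  Writing \<open>W\<close> as the sum of the indicators of \<open>\<sigma> i = i\<close> turns the mean into a sum of the defects of the
  points, which is then grouped by cells.
\<close>

lemma abs_mean_stein_operator_le:
  fixes h :: "nat \<Rightarrow> real"
  assumes h: "\<And>r. r \<ge> 1 \<Longrightarrow> \<bar>h (Suc r) - h r\<bar> \<le> 1" and n: "n \<ge> 1"
    and b: "b > 0" "\<And>k l. k < length lam \<Longrightarrow> l < length mu \<Longrightarrow> b \<le> max (lam ! k) (mu ! l)"
  shows "\<bar>measure_pmf.expectation (fp_dist n lam mu T) (\<lambda>w. fp_mean n lam mu T * h (Suc w) - real w * h w)\<bar>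
    \<le> 4 * (real (length lam) + real (length mu) - 1) / real b"
proof -
  define H where "H = (\<Sum>\<sigma>\<in>D. h (Suc (fp n \<sigma>)))"
  define N where "N = real (card D)"
  have N: "N > 0" using card_D_pos by (simp add: N_def)
  define dev where "dev i = real (card {\<tau> \<in> D. \<tau> i = i}) / N * H - (\<Sum>\<tau> | \<tau> \<in> D \<and> \<tau> i = i. h (fp n \<tau>))" for i
  have "(\<Sum>\<sigma>\<in>D. real (fp n \<sigma>) * h (fp n \<sigma>)) = (\<Sum>\<sigma>\<in>D. \<Sum>i\<in>{1..n}. of_bool (\<sigma> i = i) * h (fp n \<sigma>))"
    by (simp add: fp_def Int_def flip: sum_distrib_right)
  also have "\<dots> = (\<Sum>i\<in>{1..n}. \<Sum>\<sigma>\<in>D. of_bool (\<sigma> i = i) * h (fp n \<sigma>))"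
    by (rule sum.swap)
  also have "\<dots> = (\<Sum>i\<in>{1..n}. \<Sum>\<tau> | \<tau> \<in> D \<and> \<tau> i = i. h (fp n \<tau>))"
    by (intro sum.cong refl sum.mono_neutral_cong_right) (auto simp: finite_D)
  finally have "(\<Sum>\<sigma>\<in>D. fp_mean n lam mu T * h (Suc (fp n \<sigma>)) - real (fp n \<sigma>) * h (fp n \<sigma>))
      = fp_mean n lam mu T * H - (\<Sum>i\<in>{1..n}. \<Sum>\<tau> | \<tau> \<in> D \<and> \<tau> i = i. h (fp n \<tau>))"
    unfolding sum_subtractf H_def sum_distrib_left by (simp only:)
  also have "fp_mean n lam mu T * H = (\<Sum>i\<in>{1..n}. real (card {\<tau> \<in> D. \<tau> i = i}) / N * H)"
    unfolding fp_mean_eq N_def sum_divide_distrib sum_distrib_right ..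
  finally have "(\<Sum>\<sigma>\<in>D. fp_mean n lam mu T * h (Suc (fp n \<sigma>)) - real (fp n \<sigma>) * h (fp n \<sigma>))
      = (\<Sum>i\<in>{1..n}. dev i)"
    unfolding dev_def sum_subtractf .
  moreover have "measure_pmf.expectation (fp_dist n lam mu T) (\<lambda>w. fp_mean n lam mu T * h (Suc w) - real w * h w)
      = (\<Sum>\<sigma>\<in>D. fp_mean n lam mu T * h (Suc (fp n \<sigma>)) - real (fp n \<sigma>) * h (fp n \<sigma>)) / N"
    unfolding fp_dist_def integral_map_pmf N_def by (rule integral_pmf_of_set[OF D_nonempty finite_D])
  ultimately have "\<bar>measure_pmf.expectation (fp_dist n lam mu T) (\<lambda>w. fp_mean n lam mu T * h (Suc w) - real w * h w)\<bar>
      = \<bar>\<Sum>i\<in>{1..n}. dev i\<bar> / N"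
    using N by simp
  also have "\<dots> \<le> (\<Sum>i\<in>{1..n}. \<bar>dev i\<bar>) / N"
    using N by (intro divide_right_mono sum_abs) simp
  also have "(\<Sum>i\<in>{1..n}. \<bar>dev i\<bar>) = (\<Sum>(k, l)\<in>nonempty_cells lam mu. \<Sum>i\<in>A_cell lam mu k l. \<bar>dev i\<bar>)"
    by (rule sum_over_cells[OF sum_lam sum_mu])
  also have "\<dots> \<le> (\<Sum>(k, l)\<in>nonempty_cells lam mu. 4 * N / real b)"
  proof (rule sum_mono, clarify)
    fix k l assume "(k, l) \<in> nonempty_cells lam mu"
    then have kl: "k < length lam" "l < length mu" by (auto simp: nonempty_cells_def)
    have "(\<Sum>i\<in>A_cell lam mu k l. \<bar>dev i\<bar>) \<le> 4 * N / real (max (lam ! k) (mu ! l))"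
      unfolding dev_def H_def N_def by (rule sum_size_bias_defect_le[where h = h, OF h kl])
    also have "\<dots> \<le> 4 * N / real b"
      using b(1) b(2)[OF kl] N by (intro divide_left_mono mult_pos_pos) auto
    finally show "(\<Sum>i\<in>A_cell lam mu k l. \<bar>dev i\<bar>) \<le> 4 * N / real b" .
  qed
  also have "\<dots> = real (card (nonempty_cells lam mu)) * (4 * N / real b)"
    by (simp add: case_prod_beta)
  also have "\<dots> \<le> (real (length lam) + real (length mu) - 1) * (4 * N / real b)"
    using card_nonempty_cells[OF sum_lam sum_mu n] N by (intro mult_right_mono) auto
  finally have "\<bar>measure_pmf.expectation (fp_dist n lam mu T) (\<lambda>w. fp_mean n lam mu T * h (Suc w) - real w * h w)\<bar>
      \<le> (real (length lam) + real (length mu) - 1) * (4 * N / real b) / N"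
    using N by (simp add: divide_right_mono)
  also have "\<dots> = 4 * (real (length lam) + real (length mu) - 1) / real b"
    using N by simp
  finally show ?thesis .
qed

end

section \<open>The Poisson approximation and its limit\<close>

lemma last_le_nth:
  assumes "is_partition n lam" "k < length lam"
  shows "last lam \<le> lam ! k"
proof (cases "k = length lam - 1")
  case True
  then show ?thesis using assms(2) by (metis last_conv_nth length_0_conv less_nat_zero_code order_refl)
next
  case False
  then have "lam ! k \<ge> lam ! (length lam - 1)"
    using assms sorted_wrt_nth_less[of "(\<ge>)" lam k "length lam - 1"] by (simp add: is_partition_def)
  then show ?thesis using assms(2) by (subst last_conv_nth) auto
qed

lemma partition_nonempty:
  assumes "is_partition n lam" "n \<ge> 1"
  shows "lam \<noteq> []" "last lam > 0"
proof -
  show ne: "lam \<noteq> []" using assms by (auto simp: is_partition_def)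
  then show "last lam > 0" using assms by (auto simp: is_partition_def)
qed

lemma d_TV_fp_dist_le:
  assumes n: "1 \<le> n" and lam: "is_partition n lam" and mu: "is_partition n mu"
    and margins: "has_margins lam mu T"
    and T: "\<forall>k<length lam. \<forall>l<length mu. A_cell lam mu k l \<noteq> {} \<longrightarrow> 1 \<le> T k l"
  shows "d_TV (fp_dist n lam mu T) (poisson_dist (fp_mean n lam mu T))
    \<le> 4 * (real (length lam) + real (length mu) - 1) * min 1 (inverse (fp_mean n lam mu T))
      / real (max (last lam) (last mu))"
proof -
  interpret contingency n lam mu T
    using lam mu margins by unfold_locales (auto simp: is_partition_def)
  define b where "b = max (last lam) (last mu)"
  have b: "b > 0" using partition_nonempty(2)[OF lam n] by (simp add: b_def)
  have b_le: "b \<le> max (lam ! k) (mu ! l)" if "k < length lam" "l < length mu" for k l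
    using last_le_nth[OF lam that(1)] last_le_nth[OF mu that(2)] unfolding b_def by (rule max.mono)
  have \<nu>: "fp_mean n lam mu T > 0" by (rule fp_mean_pos[OF n T])
  have "d_TV (fp_dist n lam mu T) (poisson_pmf (fp_mean n lam mu T)) \<le>
      min 1 (inverse (fp_mean n lam mu T)) * (4 * (real (length lam) + real (length mu) - 1) / real b)"
    by (rule d_TV_poisson_le[OF \<nu>]) (rule abs_mean_stein_operator_le[OF _ n b b_le])
  then show ?thesis using \<nu> by (simp add: poisson_dist_def b_def mult_ac)
qed

text \<open>
  A distribution function is the probability of a set, so it converges at every point.
\<close>

lemma weak_conv_m_of_d_TV:
  fixes p :: "nat \<Rightarrow> nat pmf"
  assumes "(\<lambda>n. d_TV (p n) q) \<longlonglongrightarrow> 0"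
  shows "weak_conv_m (\<lambda>n. distr (measure_pmf (p n)) borel real) (distr (measure_pmf q) borel real)"
proof -
  have cdf: "cdf (distr (measure_pmf r) borel real) x = measure_pmf.prob r (real -` {..x})" for r :: "nat pmf" and x
    by (simp add: cdf_def measure_distr)
  have "(\<lambda>n. measure_pmf.prob (p n) A) \<longlonglongrightarrow> measure_pmf.prob q A" for A
    by (rule Lim_transform_bound[where g = "\<lambda>n. d_TV (p n) q" and f = "\<lambda>n. measure_pmf.prob (p n) A - measure_pmf.prob q A",
        THEN LIM_zero_cancel, rotated])
      (use assms prob_diff_le_d_TV in \<open>auto intro!: always_eventually simp: d_TV_nonneg\<close>)
  then show ?thesis
    by (simp add: weak_conv_m_def weak_conv_def cdf)
qed

lemma fp_dist_tendsto_poisson: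
  fixes lam mu :: "nat \<Rightarrow> nat list" and T :: "nat \<Rightarrow> nat \<Rightarrow> nat \<Rightarrow> nat"
  assumes A: "\<forall>n\<ge>1. is_partition n (lam n) \<and> is_partition n (mu n) \<and> has_margins (lam n) (mu n) (T n) \<and>
      (\<forall>k<length (lam n). \<forall>l<length (mu n). A_cell (lam n) (mu n) k l \<noteq> {} \<longrightarrow> 1 \<le> T n k l)"
    and lam: "filterlim (\<lambda>n. last (lam n)) at_top sequentially"
    and size: "(\<lambda>n. real (length (lam n)) + real (length (mu n)) - 1) \<longlonglongrightarrow> C"
    and mean: "(\<lambda>n. fp_mean n (lam n) (mu n) (T n)) \<longlonglongrightarrow> \<nu>"
  shows "(\<lambda>n. d_TV (fp_dist n (lam n) (mu n) (T n)) (poisson_dist \<nu>)) \<longlonglongrightarrow> 0"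
proof (rule tendsto_sandwich)
  define m s where "m n = fp_mean n (lam n) (mu n) (T n)"
    and "s n = real (length (lam n)) + real (length (mu n)) - 1" for n
  define B where "B n = 4 * s n / real (last (lam n)) + \<bar>m n - \<nu>\<bar>" for n
  have pos: "m n > 0" if "n \<ge> 1" for n
  proof -
    interpret contingency n "lam n" "mu n" "T n"
      using A that by unfold_locales (auto simp: is_partition_def)
    show ?thesis unfolding m_def using A that by (intro fp_mean_pos) auto
  qed
  have \<nu>: "\<nu> \<ge> 0"
    by (rule tendsto_lowerbound[OF mean]) (use pos in \<open>auto simp: m_def eventually_sequentially intro!: exI[of _ 1] less_imp_le\<close>)
  show "\<forall>\<^sub>F n in sequentially. 0 \<le> d_TV (fp_dist n (lam n) (mu n) (T n)) (poisson_dist \<nu>)"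
    by (simp add: d_TV_nonneg)
  show "\<forall>\<^sub>F n in sequentially. d_TV (fp_dist n (lam n) (mu n) (T n)) (poisson_dist \<nu>) \<le> B n"
    unfolding eventually_sequentially
  proof (intro exI allI impI)
    fix n :: nat assume n: "1 \<le> n"
    have hyps: "is_partition n (lam n)" "is_partition n (mu n)" "has_margins (lam n) (mu n) (T n)"
      "\<forall>k<length (lam n). \<forall>l<length (mu n). A_cell (lam n) (mu n) k l \<noteq> {} \<longrightarrow> 1 \<le> T n k l"
      using A n by auto
    have last: "last (lam n) > 0" by (rule partition_nonempty(2)[OF hyps(1) n])
    have "length (lam n) \<ge> 1" using partition_nonempty(1)[OF hyps(1) n] by (simp add: Suc_le_eq)
    then have s: "s n \<ge> 0" unfolding s_def by linarith
    have "d_TV (fp_dist n (lam n) (mu n) (T n)) (poisson_dist (m n))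
        \<le> 4 * s n * min 1 (inverse (m n)) / real (max (last (lam n)) (last (mu n)))"
      unfolding m_def s_def by (rule d_TV_fp_dist_le[OF n hyps])
    also have "\<dots> \<le> 4 * s n * 1 / real (last (lam n))"
      using s last pos[OF n] by (intro frac_le mult_left_mono mult_nonneg_nonneg) auto
    finally have "d_TV (fp_dist n (lam n) (mu n) (T n)) (poisson_dist (m n)) \<le> 4 * s n / real (last (lam n))"
      by simp
    moreover have "d_TV (poisson_dist (m n)) (poisson_dist \<nu>) \<le> \<bar>m n - \<nu>\<bar>"
      using pos[OF n] \<nu> by (intro d_TV_poisson_dist_le) auto
    ultimately show "d_TV (fp_dist n (lam n) (mu n) (T n)) (poisson_dist \<nu>) \<le> B n"
      using d_TV_triangle[of "fp_dist n (lam n) (mu n) (T n)" "poisson_dist \<nu>" "poisson_dist (m n)"]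
      unfolding B_def by linarith
  qed
  have "filterlim (\<lambda>n. real (last (lam n))) at_top sequentially"
    by (rule filterlim_compose[OF filterlim_real_sequentially lam])
  then have "(\<lambda>n. 4 * s n / real (last (lam n))) \<longlonglongrightarrow> 0"
    using size unfolding s_def
    by (intro tendsto_divide_0[where c = "4 * C"] tendsto_mult tendsto_const filterlim_at_top_imp_at_infinity)
  moreover have "(\<lambda>n. \<bar>m n - \<nu>\<bar>) \<longlonglongrightarrow> 0"
    using mean unfolding m_def by (intro tendsto_rabs_zero LIM_zero)
  ultimately show "B \<longlonglongrightarrow> 0"
    unfolding B_def using tendsto_add by fastforce
qed simp

theorem theorem1p1:
  shows
    "(\<forall>(n::nat) lam mu (T :: nat \<Rightarrow> nat \<Rightarrow> nat).
        1 \<le> n \<longrightarrow> is_partition n lam \<longrightarrow> is_partition n mu \<longrightarrow> has_margins lam mu T \<longrightarrow>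
        (\<forall>k<length lam. \<forall>l<length mu. A_cell lam mu k l \<noteq> {} \<longrightarrow> 1 \<le> T k l) \<longrightarrow>
        d_TV (fp_dist n lam mu T) (poisson_dist (fp_mean n lam mu T))
          \<le> 5 * (real (length lam) + real (length mu) - 1) * min 1 (inverse (fp_mean n lam mu T))
             / real (max (last lam) (last mu)))
     \<and>
     (\<forall>(lam :: nat \<Rightarrow> nat list) (mu :: nat \<Rightarrow> nat list) (T :: nat \<Rightarrow> nat \<Rightarrow> nat \<Rightarrow> nat)
         (C :: nat) (\<nu> :: real).
        (\<forall>n\<ge>1. is_partition n (lam n) \<and> is_partition n (mu n) \<and> has_margins (lam n) (mu n) (T n) \<and>
           (\<forall>k<length (lam n). \<forall>l<length (mu n).
              A_cell (lam n) (mu n) k l \<noteq> {} \<longrightarrow> 1 \<le> T n k l)) \<longrightarrow>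
        filterlim (\<lambda>n. last (lam n)) at_top sequentially \<longrightarrow>
        filterlim (\<lambda>n. last (mu n)) at_top sequentially \<longrightarrow>
        (\<lambda>n. real (length (lam n)) + real (length (mu n)) - 1) \<longlonglongrightarrow> real C \<longrightarrow>
        limsup (\<lambda>n. ereal (fp_mean n (lam n) (mu n) (T n))) = ereal \<nu> \<longrightarrow>
        convergent (\<lambda>n. fp_mean n (lam n) (mu n) (T n)) \<longrightarrow>
        (\<lambda>n. d_TV (fp_dist n (lam n) (mu n) (T n)) (poisson_dist \<nu>)) \<longlonglongrightarrow> 0 \<and>
        weak_conv_m (\<lambda>n. distr (measure_pmf (fp_dist n (lam n) (mu n) (T n))) borel real)
                    (distr (measure_pmf (poisson_dist \<nu>)) borel real))"
  proof (intro conjI allI impI)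
  fix n lam mu and T :: "nat \<Rightarrow> nat \<Rightarrow> nat"
  assume n: "1 \<le> n" and hyps: "is_partition n lam" "is_partition n mu" "has_margins lam mu T"
    "\<forall>k<length lam. \<forall>l<length mu. A_cell lam mu k l \<noteq> {} \<longrightarrow> 1 \<le> T k l"
  have "length lam \<ge> 1" using partition_nonempty(1)[OF hyps(1) n] by (simp add: Suc_le_eq)
  then have s: "real (length lam) + real (length mu) - 1 \<ge> 0" by linarith
  interpret contingency n lam mu T
    using hyps by unfold_locales (auto simp: is_partition_def)
  have "fp_mean n lam mu T > 0" by (rule fp_mean_pos[OF n hyps(4)])
  then have "4 * (real (length lam) + real (length mu) - 1) * min 1 (inverse (fp_mean n lam mu T))
      / real (max (last lam) (last mu)) \<le>
    5 * (real (length lam) + real (length mu) - 1) * min 1 (inverse (fp_mean n lam mu T))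
      / real (max (last lam) (last mu))"
    using s by (intro divide_right_mono mult_right_mono) auto
  with d_TV_fp_dist_le[OF n hyps]
  show "d_TV (fp_dist n lam mu T) (poisson_dist (fp_mean n lam mu T))
    \<le> 5 * (real (length lam) + real (length mu) - 1) * min 1 (inverse (fp_mean n lam mu T))
      / real (max (last lam) (last mu))" by (rule order_trans)
next
  fix lam mu :: "nat \<Rightarrow> nat list" and T :: "nat \<Rightarrow> nat \<Rightarrow> nat \<Rightarrow> nat" and C :: nat and \<nu> :: real
  assume hyps: "\<forall>n\<ge>1. is_partition n (lam n) \<and> is_partition n (mu n) \<and> has_margins (lam n) (mu n) (T n) \<and>
      (\<forall>k<length (lam n). \<forall>l<length (mu n). A_cell (lam n) (mu n) k l \<noteq> {} \<longrightarrow> 1 \<le> T n k l)"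
    and lam: "filterlim (\<lambda>n. last (lam n)) at_top sequentially"
    and size: "(\<lambda>n. real (length (lam n)) + real (length (mu n)) - 1) \<longlonglongrightarrow> real C"
    and limsup: "limsup (\<lambda>n. ereal (fp_mean n (lam n) (mu n) (T n))) = ereal \<nu>"
    and conv: "convergent (\<lambda>n. fp_mean n (lam n) (mu n) (T n))"
  obtain x where x: "(\<lambda>n. fp_mean n (lam n) (mu n) (T n)) \<longlonglongrightarrow> x"
    using conv by (auto simp: convergent_def)
  then have "limsup (\<lambda>n. ereal (fp_mean n (lam n) (mu n) (T n))) = ereal x"
    by (intro lim_imp_Limsup) auto
  with limsup x have mean: "(\<lambda>n. fp_mean n (lam n) (mu n) (T n)) \<longlonglongrightarrow> \<nu>" by simp
  show "(\<lambda>n. d_TV (fp_dist n (lam n) (mu n) (T n)) (poisson_dist \<nu>)) \<longlonglongrightarrow> 0"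
    by (rule fp_dist_tendsto_poisson[OF hyps lam size mean])
  then show "weak_conv_m (\<lambda>n. distr (measure_pmf (fp_dist n (lam n) (mu n) (T n))) borel real)
                    (distr (measure_pmf (poisson_dist \<nu>)) borel real)"
    by (rule weak_conv_m_of_d_TV)
qed

end
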